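(* Let $\alpha\vDash n$ and $\beta\vDash m$ be compositions with $\beta\subseteq\alpha$, and let $\operatorname{span}\{T: T\in \mathrm{SIT}(\alpha/\beta)\}$ denote the complex vector space with basis $\mathrm{SIT}(\alpha/\beta)$. Then: (1) $\mathcal{V}_{\alpha/\beta}=\operatorname{span}\{T:T\in\mathrm{SIT}(\alpha/\beta)\}$ is an $H_{n-m}(0)$-module for the $\mathcal{R}\mathfrak{S}^*$-action, and its quasisymmetric characteristic is $\mathcal{R}\mathfrak{S}^*_{\alpha/\beta}$. (2) $\mathcal{W}_{\alpha/\beta}=\operatorname{span}\{T:T\in\mathrm{SIT}(\alpha/\beta)\}$ is an $H_{n-m}(0)$-module for the $\mathfrak{S}^*$-action, and its quasisymmetric characteristic is $\mathfrak{S}^*_{\alpha/\beta}$. (3) $\mathcal{A}_{\alpha/\beta}=\operatorname{span}\{T:T\in\mathrm{SIT}(\alpha/\beta)\}$ is an $H_{n-m}(0)$-module for the $\mathcal{A}^*$-action, and its quasisymmetric characteristic is $\mathcal{A}^*_{\alpha/\beta}$. (4) $\overline{\mathcal{A}}_{\alpha/\beta}=\operatorname{span}\{T:T\in\mathrm{SIT}(\alpha/\beta)\}$ is an $H_{n-m}(0)$-module for the $\overline{\mathcal{A}}^*$-action, and its quasisymmetric characteristic is $\overline{\mathcal{A}}^*_{\alpha/\beta}$.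
   Context: Compositions and tableaux. A composition $\alpha=(\alpha_1,\dots,\alpha_k)\vDash n$ is a finite sequence of positive integers with sum $n=|\alpha|$; $\ell(\alpha)=k$; $\emptyset$ is the empty composition of $0$. The diagram of $\alpha$ is the left-justified array of cells with $\alpha_i$ cells in row $i$, rows numbered from bottom to top. $\beta\subseteq\alpha$ means $\ell(\beta)\le\ell(\alpha)$ and $\beta_j\le\alpha_j$ for all $1\le j\le \ell(\beta)$; the skew diagram $\alpha/\beta$ is the set of cells of the diagram of $\alpha$ not in that of $\beta$, where $\beta$ is placed in the bottom-left corner of $\alpha$. $\mathrm{SIT}(\alpha/\beta)$ is the set of skew standard immaculate tableaux: bijective fillings of the cells of $\alpha/\beta$ with $1,2,\dots,|\alpha|-|\beta|$ such that the entries in the cells of the leftmost column of $\alpha$ that are not in $\beta$ increase from bottom to top, and all rows increase from left to right. Descent sets. For $T\in\mathrm{SIT}(\alpha/\beta)$ and $1\le i\le |\alpha|-|\beta|-1$: $i\in\mathrm{Des}_{\mathfrak{S}^*}(T)$ iff $i+1$ is in a row strictly above $i$; $i\in\mathrm{Des}_{\mathcal{R}\mathfrak{S}^*}(T)$ iff $i+1$ is in a row weakly below $i$; $i\in\mathrm{Des}_{\mathcal{A}^*}(T)$ iff $i+1$ is in a row strictly below $i$; $i\in\mathrm{Des}_{\overline{\mathcal{A}}^*}(T)$ iff $i+1$ is in a row weakly above $i$. 0-Hecke algebra and actions. $H_N(0)$ is the $\mathbb{C}$-algebra with generators $\pi_1,\dots,\pi_{N-1}$ and relations $\pi_i^2=\pi_i$,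 $\pi_i\pi_{i+1}\pi_i=\pi_{i+1}\pi_i\pi_{i+1}$, $\pi_i\pi_j=\pi_j\pi_i$ for $|i-j|\ge2$. Let $s_i$ switch the entries $i,i+1$ of a tableau. For $a\in\{\mathfrak{S}^*,\mathcal{R}\mathfrak{S}^*,\mathcal{A}^*,\overline{\mathcal{A}}^*\}$, the $a$-action is given on basis elements $T\in\mathrm{SIT}(\alpha/\beta)$ by $\pi_i^a(T)=T$ if $i\notin\mathrm{Des}_a(T)$; $\pi_i^a(T)=s_i(T)$ if $i\in\mathrm{Des}_a(T)$ and $s_i(T)\in\mathrm{SIT}(\alpha/\beta)$; $\pi_i^a(T)=0$ otherwise. Quasisymmetric functions. For $S=\{s_1<\dots<s_j\}\subseteq\{1,\dots,N-1\}$, $\mathrm{comp}(S)=(s_1,s_2-s_1,\dots,N-s_j)\vDash N$, with inverse $\mathrm{set}(\gamma)=\{\gamma_1,\gamma_1+\gamma_2,\dots,\gamma_1+\dots+\gamma_{\ell(\gamma)-1}\}$. For $\gamma\vDash N$, $F_\gamma=\sum x_{i_1}\cdots x_{i_N}$ over $i_1\le\cdots\le i_N$ with $i_j<i_{j+1}$ if $j\in\mathrm{set}(\gamma)$. The simple $H_N(0)$-modules are the one-dimensional $L_\gamma=\mathrm{span}\{v_\gamma\}$, $\gamma\vDash N$, with $\pi_i v_\gamma=0$ if $i\in\mathrm{set}(\gamma)$ and $\pi_iv_\gamma=v_\gamma$ otherwise. The quasisymmetric characteristic of a finite-dimensional $H_N(0)$-module $M$ is the sum of $F_{\gamma}$ over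 the composition factors $L_{\gamma}$ of $M$ (with multiplicity). For each of the four $a$, define $a_{\alpha/\beta}=\sum_{T\in\mathrm{SIT}(\alpha/\beta)}F_{\mathrm{comp}(\mathrm{Des}_a(T))}$; this defines $\mathfrak{S}^*_{\alpha/\beta}$, $\mathcal{R}\mathfrak{S}^*_{\alpha/\beta}$, $\mathcal{A}^*_{\alpha/\beta}$, $\overline{\mathcal{A}}^*_{\alpha/\beta}$. *)

theory Defs
  imports
    Complex_Main
    "HOL-Library.Multiset"
    "HOL-Library.FuncSet"
    "HOL-Library.Poly_Mapping"
    "HOL-Algebra.Module"
    "HOL-Algebra.QuotRing"
    "HOL-Combinatorics.Transposition"
begin

section \<open>Compositions and quasisymmetric functions\<close>

definition composition :: "nat \<Rightarrow> nat list \<Rightarrow> bool" where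
  "composition n \<alpha> \<longleftrightarrow> (\<forall>a\<in>set \<alpha>. 0 < a) \<and> sum_list \<alpha> = n"

definition comp_contained :: "nat list \<Rightarrow> nat list \<Rightarrow> bool" where
  "comp_contained \<beta> \<alpha> \<longleftrightarrow> length \<beta> \<le> length \<alpha> \<and> (\<forall>j<length \<beta>. \<beta> ! j \<le> \<alpha> ! j)"

text \<open>The composition of \<open>N\<close> attached to a subset of \<open>{1, \<dots>, N - 1}\<close>. For \<open>N = 0\<close> it is the
  empty composition, which the general formula would miss.\<close>

definition comp_of_set :: "nat \<Rightarrow> nat set \<Rightarrow> nat list" where
  "comp_of_set N S =
    (if N = 0 then []
     else let xs = sorted_list_of_set S @ [N] in map2 (-) xs (0 # butlast xs))"

definition set_of_comp :: "nat list \<Rightarrow> nat set" where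
  "set_of_comp \<gamma> = {sum_list (take i \<gamma>) | i. 1 \<le> i \<and> i < length \<gamma>}"

text \<open>A formal power series in \<open>x\<^sub>1, x\<^sub>2, \<dots>\<close> is the function giving the coefficient of each
  monomial; a monomial is the multiset of the indices of its variables.\<close>

type_synonym power_series = "nat multiset \<Rightarrow> int"

definition fundamental_qsym :: "nat list \<Rightarrow> power_series" where
  "fundamental_qsym \<gamma> = (\<lambda>m. int (card
     {xs. length xs = sum_list \<gamma> \<and> set xs \<subseteq> {1..} \<and> sorted xs \<and>
          (\<forall>j\<in>set_of_comp \<gamma>. xs ! (j - 1) < xs ! j) \<and> mset xs = m}))"

section \<open>Skew standard immaculate tableaux\<close>

text \<open>Cells are pairs (row, column), both counted from 0; row 0 is the bottom row and column 0
  the leftmost column.\<close>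

type_synonym cell = "nat \<times> nat"
type_synonym tableau = "cell \<Rightarrow> nat"

definition diagram :: "nat list \<Rightarrow> cell set" where
  "diagram \<alpha> = {(r, c). r < length \<alpha> \<and> c < \<alpha> ! r}"

definition skew_diagram :: "nat list \<Rightarrow> nat list \<Rightarrow> cell set" where
  "skew_diagram \<alpha> \<beta> = diagram \<alpha> - diagram \<beta>"

definition skew_size :: "nat list \<Rightarrow> nat list \<Rightarrow> nat" where
  "skew_size \<alpha> \<beta> = sum_list \<alpha> - sum_list \<beta>"

definition SIT :: "nat list \<Rightarrow> nat list \<Rightarrow> tableau set" where
  "SIT \<alpha> \<beta> = {T \<in> extensional (skew_diagram \<alpha> \<beta>).
     bij_betw T (skew_diagram \<alpha> \<beta>) {1..skew_size \<alpha> \<beta>} \<and>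
     (\<forall>r r'. (r, 0) \<in> skew_diagram \<alpha> \<beta> \<longrightarrow> (r', 0) \<in> skew_diagram \<alpha> \<beta> \<longrightarrow> r < r' \<longrightarrow>
        T (r, 0) < T (r', 0)) \<and>
     (\<forall>r c c'. (r, c) \<in> skew_diagram \<alpha> \<beta> \<longrightarrow> (r, c') \<in> skew_diagram \<alpha> \<beta> \<longrightarrow> c < c' \<longrightarrow>
        T (r, c) < T (r, c'))}"

definition row_of :: "nat list \<Rightarrow> nat list \<Rightarrow> tableau \<Rightarrow> nat \<Rightarrow> nat" where
  "row_of \<alpha> \<beta> T i = (THE r. \<exists>c. (r, c) \<in> skew_diagram \<alpha> \<beta> \<and> T (r, c) = i)"

datatype action_kind = S_star | RS_star | A_star | Abar_star

text \<open>\<open>descent_rel a r r'\<close>: is \<open>i\<close> a descent when \<open>i\<close> lies in row \<open>r\<close> and \<open>i + 1\<close> in row \<open>r'\<close>?\<close>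

fun descent_rel :: "action_kind \<Rightarrow> nat \<Rightarrow> nat \<Rightarrow> bool" where
  "descent_rel S_star r r' \<longleftrightarrow> r' > r"
| "descent_rel RS_star r r' \<longleftrightarrow> r' \<le> r"
| "descent_rel A_star r r' \<longleftrightarrow> r' < r"
| "descent_rel Abar_star r r' \<longleftrightarrow> r' \<ge> r"

definition Des :: "action_kind \<Rightarrow> nat list \<Rightarrow> nat list \<Rightarrow> tableau \<Rightarrow> nat set" where
  "Des a \<alpha> \<beta> T =
    {i \<in> {1..<skew_size \<alpha> \<beta>}. descent_rel a (row_of \<alpha> \<beta> T i) (row_of \<alpha> \<beta> T (i + 1))}"

definition skew_qsym :: "action_kind \<Rightarrow> nat list \<Rightarrow> nat list \<Rightarrow> power_series" where
  "skew_qsym a \<alpha> \<beta> =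
    (\<lambda>m. \<Sum>T\<in>SIT \<alpha> \<beta>. fundamental_qsym (comp_of_set (skew_size \<alpha> \<beta>) (Des a \<alpha> \<beta> T)) m)"

definition swap_entries :: "nat list \<Rightarrow> nat list \<Rightarrow> nat \<Rightarrow> tableau \<Rightarrow> tableau" where
  "swap_entries \<alpha> \<beta> i T = restrict (transpose i (i + 1) \<circ> T) (skew_diagram \<alpha> \<beta>)"

text \<open>Finitely supported functions on tableaux are the formal complex linear combinations.\<close>

definition basis_vector :: "tableau \<Rightarrow> tableau \<Rightarrow>\<^sub>0 complex" where
  "basis_vector T = Poly_Mapping.single T 1"

definition pi_action ::
    "action_kind \<Rightarrow> nat list \<Rightarrow> nat list \<Rightarrow> nat \<Rightarrow> tableau \<Rightarrow> tableau \<Rightarrow>\<^sub>0 complex" where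
  "pi_action a \<alpha> \<beta> i T =
    (if i \<notin> Des a \<alpha> \<beta> T then basis_vector T
     else if swap_entries \<alpha> \<beta> i T \<in> SIT \<alpha> \<beta> then basis_vector (swap_entries \<alpha> \<beta> i T)
     else 0)"

section \<open>The 0-Hecke algebra\<close>

text \<open>Words in the generator indices form a monoid under concatenation, written additively so
  that the convolution product on \<open>hword \<Rightarrow>\<^sub>0 complex\<close> is that of the free algebra.\<close>

datatype hword = HWord (letters: "nat list")

instantiation hword :: monoid_add
begin
definition zero_hword :: hword where "zero_hword = HWord []"
definition plus_hword :: "hword \<Rightarrow> hword \<Rightarrow> hword" where
  "plus_hword u v = HWord (letters u @ letters v)"
instance by standard (simp_all add: zero_hword_def plus_hword_def)
end

type_synonym free_elem = "hword \<Rightarrow>\<^sub>0 complex"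

definition free_algebra :: "nat \<Rightarrow> free_elem ring" where
  "free_algebra N =
    \<lparr>carrier = {p. \<forall>w\<in>Poly_Mapping.keys p. set (letters w) \<subseteq> {1..<N}},
     mult = (*), one = 1, zero = 0, add = (+)\<rparr>"

definition free_gen :: "nat \<Rightarrow> free_elem" where
  "free_gen i = Poly_Mapping.single (HWord [i]) 1"

definition hecke_relators :: "nat \<Rightarrow> free_elem set" where
  "hecke_relators N =
     {free_gen i * free_gen i - free_gen i | i. i \<in> {1..<N}} \<union>
     {free_gen i * free_gen (i + 1) * free_gen i -
      free_gen (i + 1) * free_gen i * free_gen (i + 1) | i. i \<in> {1..<N} \<and> i + 1 \<in> {1..<N}} \<union>
     {free_gen i * free_gen j - free_gen j * free_gen i | i j.
        i \<in> {1..<N} \<and> j \<in> {1..<N} \<and> (i + 2 \<le> j \<or> j + 2 \<le> i)}"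

definition hecke_ideal :: "nat \<Rightarrow> free_elem set" where
  "hecke_ideal N = genideal (free_algebra N) (hecke_relators N)"

definition hecke :: "nat \<Rightarrow> free_elem set ring" where
  "hecke N = free_algebra N Quot hecke_ideal N"

definition hecke_class :: "nat \<Rightarrow> free_elem \<Rightarrow> free_elem set" where
  "hecke_class N p = hecke_ideal N +>\<^bsub>free_algebra N\<^esub> p"

definition hecke_gen :: "nat \<Rightarrow> nat \<Rightarrow> free_elem set" where
  "hecke_gen N i = hecke_class N (free_gen i)"

text \<open>The image of a complex number under the structure map of the complex algebra.\<close>

definition hecke_scalar :: "nat \<Rightarrow> complex \<Rightarrow> free_elem set" where
  "hecke_scalar N c = hecke_class N (Poly_Mapping.single 0 c)"

section \<open>Modules over a noncommutative ring\<close>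

text \<open>The locale \<^locale>\<open>module\<close> assumes a commutative ring of scalars; this is the same notion
  without commutativity.\<close>

locale left_module = R?: ring R + M?: abelian_group M for R (structure) and M (structure) +
  assumes smult_closed:
      "\<lbrakk>a \<in> carrier R; x \<in> carrier M\<rbrakk> \<Longrightarrow> a \<odot>\<^bsub>M\<^esub> x \<in> carrier M"
    and smult_l_distr:
      "\<lbrakk>a \<in> carrier R; b \<in> carrier R; x \<in> carrier M\<rbrakk> \<Longrightarrow>
        (a \<oplus>\<^bsub>R\<^esub> b) \<odot>\<^bsub>M\<^esub> x = a \<odot>\<^bsub>M\<^esub> x \<oplus>\<^bsub>M\<^esub> b \<odot>\<^bsub>M\<^esub> x"
    and smult_r_distr:
      "\<lbrakk>a \<in> carrier R; x \<in> carrier M; y \<in> carrier M\<rbrakk> \<Longrightarrow>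
        a \<odot>\<^bsub>M\<^esub> (x \<oplus>\<^bsub>M\<^esub> y) = a \<odot>\<^bsub>M\<^esub> x \<oplus>\<^bsub>M\<^esub> a \<odot>\<^bsub>M\<^esub> y"
    and smult_assoc1:
      "\<lbrakk>a \<in> carrier R; b \<in> carrier R; x \<in> carrier M\<rbrakk> \<Longrightarrow>
        (a \<otimes>\<^bsub>R\<^esub> b) \<odot>\<^bsub>M\<^esub> x = a \<odot>\<^bsub>M\<^esub> (b \<odot>\<^bsub>M\<^esub> x)"
    and smult_one:
      "x \<in> carrier M \<Longrightarrow> \<one>\<^bsub>R\<^esub> \<odot>\<^bsub>M\<^esub> x = x"

text \<open>The record type \<^typ>\<open>('a, 'b) module\<close> has ring fields \<open>mult\<close> and \<open>one\<close> that modules do not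
  use; they are left unspecified.\<close>

definition quotient_module :: "('a, 'b) module \<Rightarrow> 'b set \<Rightarrow> ('a, 'b set) module" where
  "quotient_module M U =
    \<lparr>carrier = a_rcosets\<^bsub>M\<^esub> U, mult = undefined, one = undefined,
     zero = U, add = set_add M,
     smult = (\<lambda>r X. \<Union>x\<in>X. U +>\<^bsub>M\<^esub> (r \<odot>\<^bsub>M\<^esub> x))\<rparr>"

definition simple_module :: "'a ring \<Rightarrow> ('a, 'b) module \<Rightarrow> bool" where
  "simple_module R M \<longleftrightarrow> left_module R M \<and> carrier M \<noteq> {\<zero>\<^bsub>M\<^esub>} \<and>
    (\<forall>U. submodule U R M \<longrightarrow> U = {\<zero>\<^bsub>M\<^esub>} \<or> U = carrier M)"

text \<open>The factor \<open>U\<^sub>i\<^sub>+\<^sub>1 / U\<^sub>i\<close> of a chain \<open>Us\<close> of submodules of \<open>M\<close>.\<close>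

definition chain_factor ::
    "('a, 'b) module \<Rightarrow> 'b set list \<Rightarrow> nat \<Rightarrow> ('a, 'b set) module" where
  "chain_factor M Us i = quotient_module (M\<lparr>carrier := Us ! (i + 1)\<rparr>) (Us ! i)"

definition composition_series :: "'a ring \<Rightarrow> ('a, 'b) module \<Rightarrow> 'b set list \<Rightarrow> bool" where
  "composition_series R M Us \<longleftrightarrow>
     Us \<noteq> [] \<and> hd Us = {\<zero>\<^bsub>M\<^esub>} \<and> last Us = carrier M \<and>
     (\<forall>U\<in>set Us. submodule U R M) \<and>
     (\<forall>i. i + 1 < length Us \<longrightarrow>
        Us ! i \<subseteq> Us ! (i + 1) \<and> simple_module R (chain_factor M Us i))"

section \<open>The quasisymmetric characteristic\<close>

text \<open>\<open>Q\<close> is (a copy of) the one-dimensional module \<open>L\<^sub>\<gamma>\<close>. The conditions determine \<open>Q\<close> up to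
  isomorphism, since the generators generate the algebra.\<close>

definition is_L :: "nat \<Rightarrow> nat list \<Rightarrow> (free_elem set, 'b) module \<Rightarrow> bool" where
  "is_L N \<gamma> Q \<longleftrightarrow> left_module (hecke N) Q \<and>
    (\<exists>v\<in>carrier Q. v \<noteq> \<zero>\<^bsub>Q\<^esub> \<and> carrier Q = {hecke_scalar N c \<odot>\<^bsub>Q\<^esub> v | c. True} \<and>
      (\<forall>i\<in>{1..<N}. hecke_gen N i \<odot>\<^bsub>Q\<^esub> v = (if i \<in> set_of_comp \<gamma> then \<zero>\<^bsub>Q\<^esub> else v)))"

text \<open>The number of composition factors of \<open>M\<close> isomorphic to \<open>L\<^sub>\<gamma>\<close>; that it does not depend on
  the composition series is the Jordan-Hoelder theorem.\<close>

definition multiplicity_L :: "nat \<Rightarrow> (free_elem set, 'b) module \<Rightarrow> nat list \<Rightarrow> nat" where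
  "multiplicity_L N M \<gamma> = (THE k. \<exists>Us. composition_series (hecke N) M Us \<and>
     k = card {i. i + 1 < length Us \<and> is_L N \<gamma> (chain_factor M Us i)})"

definition qsym_characteristic :: "nat \<Rightarrow> (free_elem set, 'b) module \<Rightarrow> power_series" where
  "qsym_characteristic N M =
    (\<lambda>m. \<Sum>\<gamma> | composition N \<gamma>. int (multiplicity_L N M \<gamma>) * fundamental_qsym \<gamma> m)"

section \<open>Tableau modules\<close>

text \<open>The complex vector space with basis \<open>SIT \<alpha> \<beta>\<close>, with a candidate scalar multiplication.\<close>

definition tableau_module ::
    "nat list \<Rightarrow> nat list \<Rightarrow>
     (free_elem set \<Rightarrow> (tableau \<Rightarrow>\<^sub>0 complex) \<Rightarrow> (tableau \<Rightarrow>\<^sub>0 complex)) \<Rightarrow>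
     (free_elem set, tableau \<Rightarrow>\<^sub>0 complex) module" where
  "tableau_module \<alpha> \<beta> act =
    \<lparr>carrier = {v. Poly_Mapping.keys v \<subseteq> SIT \<alpha> \<beta>}, mult = undefined, one = undefined,
     zero = 0, add = (+), smult = act\<rparr>"

text \<open>\<open>act\<close> makes this space a module over the complex algebra \<open>H\<^sub>N(0)\<close>, inducing the given
  complex vector space structure and extending the \<open>a\<close>-action of the generators on tableaux.\<close>

definition extends_action ::
    "nat \<Rightarrow> action_kind \<Rightarrow> nat list \<Rightarrow> nat list \<Rightarrow>
     (free_elem set \<Rightarrow> (tableau \<Rightarrow>\<^sub>0 complex) \<Rightarrow> (tableau \<Rightarrow>\<^sub>0 complex)) \<Rightarrow> bool" where
  "extends_action N a \<alpha> \<beta> act \<longleftrightarrow>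
     left_module (hecke N) (tableau_module \<alpha> \<beta> act) \<and>
     (\<forall>c. \<forall>v\<in>carrier (tableau_module \<alpha> \<beta> act).
        act (hecke_scalar N c) v = Poly_Mapping.map ((*) c) v) \<and>
     (\<forall>i\<in>{1..<N}. \<forall>T\<in>SIT \<alpha> \<beta>. act (hecke_gen N i) (basis_vector T) = pi_action a \<alpha> \<beta> i T)"

end

theory Submission
  imports Defs
begin

text \<open>
  Each of the four descent conditions compares the cells of \<open>i\<close> and \<open>i + 1\<close> in a total order on
  the cells, so the tableaux are the linear extensions of a labelled poset. On all bijective
  fillings, the operators that sort the adjacent entries \<open>i\<close>, \<open>i + 1\<close> satisfy the relations of the
  0-Hecke algebra. Sorting never undoes a pair that is already in order; hence a filling reached
  from a linear extension is a linear extension or violates a relation \<open>x < y\<close> whose order \<open>\<kappa>\<close>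
  reverses, and fillings of the second kind are preserved by sorting. Setting them to zero
  therefore keeps the relations.

  Swapping a descent increases \<open>\<Sum>x. \<kappa> x * T x\<close>, so the tableaux in order of decreasing weight
  span a flag of submodules whose factors are the modules \<open>L\<close> of the descent compositions. As in
  the proof of the Jordan-Hoelder theorem, comparing any composition series with this flag matches
  its factors with the tableaux.
\<close>

section \<open>Left modules and their quotients\<close>

text \<open>The multiplicities in the characteristic are definite descriptions over all composition
  series, and the statement ranges over every \<open>act\<close> that extends the action on
  tableaux. One module with one good flag is therefore not enough: every such \<open>act\<close>
  must be shown to agree with the sorting operators on the span, and every series must give the same
  count. The delicate point in the relations is the value zero. A braid relation compares two paths
  of swaps, and it would fail if one path could leave the tableaux and come back while the other
  stayed inside. Strict and weak comparison of rows fit one scheme because rows increase: if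
  \<open>i\<close> and \<open>i + 1\<close> share a row, then \<open>i + 1\<close> lies to the
  right. Breaking ties by column in one direction makes such a pair never a descent, in the other
  direction always one.\<close>

context left_module
begin

lemma zero_smult: "x \<in> carrier M \<Longrightarrow> \<zero>\<^bsub>R\<^esub> \<odot>\<^bsub>M\<^esub> x = \<zero>\<^bsub>M\<^esub>"
  using smult_l_distr[of "\<zero>\<^bsub>R\<^esub>" "\<zero>\<^bsub>R\<^esub>" x] smult_closed[of "\<zero>\<^bsub>R\<^esub>" x]
  by (simp add: M.add.r_cancel_one')

lemma smult_zero: "a \<in> carrier R \<Longrightarrow> a \<odot>\<^bsub>M\<^esub> \<zero>\<^bsub>M\<^esub> = \<zero>\<^bsub>M\<^esub>"
  using smult_r_distr[of a "\<zero>\<^bsub>M\<^esub>" "\<zero>\<^bsub>M\<^esub>"] smult_closed[of a "\<zero>\<^bsub>M\<^esub>"]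
  by (simp add: M.add.r_cancel_one')

end

lemma left_module_restrict:
  assumes "left_module R M" and "submodule W R M"
  shows "left_module R (M\<lparr>carrier := W\<rparr>)"
proof -
  interpret left_module R M by fact
  interpret W: submodule W R M by fact
  have WM: "x \<in> carrier M" if "x \<in> W" for x using that W.subset by auto
  have "abelian_group (M\<lparr>carrier := W\<rparr>)"
  proof (rule abelian_groupI, simp_all add: W.m_closed W.one_closed WM M.a_assoc)
    fix x assume x: "x \<in> W"
    then have "\<ominus>\<^bsub>M\<^esub> x \<in> W" using W.m_inv_closed[of x] by (simp add: a_inv_def)
    then show "\<exists>y\<in>W. y \<oplus>\<^bsub>M\<^esub> x = \<zero>\<^bsub>M\<^esub>"
      using M.l_neg[OF WM[OF x]] by blast
  qed (use W.m_closed W.one_closed M.a_comm[OF WM WM] in simp_all)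
  then show ?thesis
    by (simp add: left_module_def left_module_axioms_def R.ring_axioms WM W.smult_closed
        smult_l_distr smult_r_distr smult_assoc1 smult_one)
qed

lemma submodule_restrict:
  assumes "submodule U R M" and "submodule W R M" and "abelian_group M" and "U \<subseteq> W"
  shows "submodule U R (M\<lparr>carrier := W\<rparr>)"
proof -
  interpret abelian_group M by fact
  have "subgroup U (add_monoid M\<lparr>carrier := W\<rparr>)"
    by (intro add.subgroup_incl submodule.axioms(1)[OF assms(1)]
        submodule.axioms(1)[OF assms(2)] assms(4))
  then show ?thesis
    using assms(1) by (simp add: submodule_def submodule_axioms_def)
qed

locale module_quotient = left_module R M for R (structure) and M :: "('a, 'b) module" (structure) +
  fixes U
  assumes submod: "submodule U R M"
begin

sublocale U: submodule U R M by (fact submod)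

sublocale U: abelian_subgroup U M
  by (rule abelian_subgroupI3[OF additive_subgroupI[OF U.subgroup_axioms] M.abelian_group_axioms])

lemma carrier_quotient: "carrier (quotient_module M U) = (\<lambda>x. U +>\<^bsub>M\<^esub> x) ` carrier M"
  by (auto simp: quotient_module_def A_RCOSETS_def')

lemma zero_quotient: "\<zero>\<^bsub>quotient_module M U\<^esub> = U +>\<^bsub>M\<^esub> \<zero>\<^bsub>M\<^esub>"
  using U.a_subset by (simp add: quotient_module_def)

lemma add_quotient:
  assumes "x \<in> carrier M" "y \<in> carrier M"
  shows "(U +>\<^bsub>M\<^esub> x) \<oplus>\<^bsub>quotient_module M U\<^esub> (U +>\<^bsub>M\<^esub> y) = U +>\<^bsub>M\<^esub> (x \<oplus>\<^bsub>M\<^esub> y)"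
  using U.a_rcos_sum[OF assms] by (simp add: quotient_module_def)

text \<open>The product in \<open>quotient_module\<close> is a union over all representatives of the
  coset. Representatives differ by elements of \<open>U\<close>, and \<open>U\<close> is stable
  under \<open>r\<close>, so this is a nonempty union of equal cosets.\<close>

lemma smult_quotient:
  assumes "r \<in> carrier R" "x \<in> carrier M"
  shows "r \<odot>\<^bsub>quotient_module M U\<^esub> (U +>\<^bsub>M\<^esub> x) = U +>\<^bsub>M\<^esub> (r \<odot>\<^bsub>M\<^esub> x)"
proof -
  have "U +>\<^bsub>M\<^esub> (r \<odot>\<^bsub>M\<^esub> y) = U +>\<^bsub>M\<^esub> (r \<odot>\<^bsub>M\<^esub> x)" if y: "y \<in> U +>\<^bsub>M\<^esub> x" for y
  proof -
    obtain u where u: "u \<in> U" "y = u \<oplus>\<^bsub>M\<^esub> x" using y by (auto simp: a_r_coset_def')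
    have uc: "u \<in> carrier M" "r \<odot>\<^bsub>M\<^esub> u \<in> U"
      using u assms U.a_subset U.smult_closed by auto
    have "r \<odot>\<^bsub>M\<^esub> y = r \<odot>\<^bsub>M\<^esub> u \<oplus>\<^bsub>M\<^esub> r \<odot>\<^bsub>M\<^esub> x"
      using u uc assms by (simp add: smult_r_distr)
    then have "r \<odot>\<^bsub>M\<^esub> y \<in> U +>\<^bsub>M\<^esub> (r \<odot>\<^bsub>M\<^esub> x)"
      using uc by (auto simp: a_r_coset_def')
    then show ?thesis
      using M.a_repr_independence[OF _ _ U.a_subgroup] smult_closed assms by metis
  qed
  moreover have "U +>\<^bsub>M\<^esub> x \<noteq> {}" using U.a_rcos_self[OF assms(2)] by auto
  ultimately show ?thesis by (simp add: quotient_module_def)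
qed

lemma left_module_quotient: "left_module R (quotient_module M U)"
proof -
  have "abelian_group (quotient_module M U)"
    by (rule abelian_groupI)
      (use M.l_neg M.a_inv_closed in \<open>auto simp: carrier_quotient zero_quotient add_quotient
        M.a_ac M.r_neg intro!: bexI[where x = "\<ominus>\<^bsub>M\<^esub> x" for x] arg_cong[of _ _ "\<lambda>z. U +>\<^bsub>M\<^esub> z"]\<close>)
  then show ?thesis
    unfolding left_module_def left_module_axioms_def
    using R.ring_axioms
    by (auto simp: carrier_quotient smult_quotient add_quotient smult_closed
        smult_l_distr smult_r_distr smult_assoc1 smult_one)
qed

lemma submodule_quotient:
  assumes "submodule W R M"
  shows "submodule ((\<lambda>x. U +>\<^bsub>M\<^esub> x) ` W) R (quotient_module M U)"
proof -
  interpret W: submodule W R M by fact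
  interpret Q: left_module R "quotient_module M U" by (rule left_module_quotient)
  have W: "x \<in> carrier M" if "x \<in> W" for x using that W.subset by auto
  have Winv: "\<ominus>\<^bsub>M\<^esub> x \<in> W" if "x \<in> W" for x
    using W.m_inv_closed that by (simp add: a_inv_def)
  have inv: "\<ominus>\<^bsub>quotient_module M U\<^esub> (U +>\<^bsub>M\<^esub> x) = U +>\<^bsub>M\<^esub> (\<ominus>\<^bsub>M\<^esub> x)" if "x \<in> carrier M" for x
    by (rule Q.minus_equality)
      (use that in \<open>auto simp: carrier_quotient add_quotient zero_quotient M.l_neg\<close>)
  have "subgroup ((\<lambda>x. U +>\<^bsub>M\<^esub> x) ` W) (add_monoid (quotient_module M U))"
  proof (rule Q.add.subgroupI)
    show "\<ominus>\<^bsub>quotient_module M U\<^esub> a \<in> (\<lambda>x. U +>\<^bsub>M\<^esub> x) ` W"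
      if "a \<in> (\<lambda>x. U +>\<^bsub>M\<^esub> x) ` W" for a
      using that inv W Winv by auto
  qed (use W W.m_closed W.one_closed in \<open>auto simp: carrier_quotient add_quotient\<close>)
  then show ?thesis
    using W by (auto simp: submodule_def submodule_axioms_def smult_quotient)
qed

end

section \<open>Representations of the 0-Hecke algebra\<close>

abbreviation scale :: "complex \<Rightarrow> ('b \<Rightarrow>\<^sub>0 complex) \<Rightarrow> ('b \<Rightarrow>\<^sub>0 complex)" where
  "scale c v \<equiv> Poly_Mapping.map ((*) c) v"

lemma lookup_scale [simp]: "Poly_Mapping.lookup (scale c v) k = c * Poly_Mapping.lookup v k"
  by (simp add: Poly_Mapping.map.rep_eq when_def)

lemma scale_add_right: "scale c (u + v) = scale c u + scale c v"
  by (rule poly_mapping_eqI) (simp add: lookup_add algebra_simps)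

lemma scale_add_left: "scale (c + d) v = scale c v + scale d v"
  by (rule poly_mapping_eqI) (simp add: lookup_add algebra_simps)

lemma scale_scale [simp]: "scale c (scale d v) = scale (c * d) v"
  by (rule poly_mapping_eqI) simp

lemma scale_one [simp]: "scale 1 v = v"
  by (rule poly_mapping_eqI) simp

lemma scale_zero_left [simp]: "scale 0 v = 0"
  by (rule poly_mapping_eqI) simp

lemma scale_minus_one: "scale (- 1) v = - v"
  by (rule poly_mapping_eqI) simp

lemma scale_sum: "scale c (sum f A) = (\<Sum>a\<in>A. scale c (f a))"
  by (rule poly_mapping_eqI) (simp add: lookup_sum sum_distrib_left)

lemma keys_scale: "Poly_Mapping.keys (scale c v) \<subseteq> Poly_Mapping.keys v"
  by (auto simp: in_keys_iff)

lemma poly_mapping_sum_single: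
  fixes p :: "'a \<Rightarrow>\<^sub>0 'b::comm_monoid_add"
  shows "p = (\<Sum>k\<in>Poly_Mapping.keys p. Poly_Mapping.single k (Poly_Mapping.lookup p k))"
  by (rule poly_mapping_eqI)
    (simp add: lookup_sum lookup_single when_def sum.delta' in_keys_iff)

text \<open>The single case is restricted to the actual terms of \<open>p\<close>, so that a bound
  on the support of \<open>p\<close> in the context can be used there; the sum case has to hold for
  arbitrary summands.\<close>

lemma poly_mapping_single_induct [case_names zero single add]:
  fixes p :: "'a \<Rightarrow>\<^sub>0 'b::comm_monoid_add"
  assumes "P 0"
    and "\<And>k. k \<in> Poly_Mapping.keys p \<Longrightarrow> P (Poly_Mapping.single k (Poly_Mapping.lookup p k))"
    and "\<And>f g. P f \<Longrightarrow> P g \<Longrightarrow> P (f + g)"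
  shows "P p"
proof -
  have "P (\<Sum>k\<in>A. Poly_Mapping.single k (Poly_Mapping.lookup p k))"
    if "finite A" "A \<subseteq> Poly_Mapping.keys p" for A
    using that by (induction A) (use assms in auto)
  then show ?thesis by (metis finite_keys order_refl poly_mapping_sum_single)
qed

definition lin_extend :: "('b \<Rightarrow> 'c \<Rightarrow>\<^sub>0 complex) \<Rightarrow> ('b \<Rightarrow>\<^sub>0 complex) \<Rightarrow> ('c \<Rightarrow>\<^sub>0 complex)" where
  "lin_extend f v = (\<Sum>k\<in>Poly_Mapping.keys v. scale (Poly_Mapping.lookup v k) (f k))"

lemma lin_extend_superset:
  assumes "finite A" "Poly_Mapping.keys v \<subseteq> A"
  shows "lin_extend f v = (\<Sum>k\<in>A. scale (Poly_Mapping.lookup v k) (f k))"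
  unfolding lin_extend_def
  by (rule sum.mono_neutral_left) (use assms in \<open>auto simp: in_keys_iff\<close>)

lemma lin_extend_add: "lin_extend f (u + v) = lin_extend f u + lin_extend f v"
proof -
  let ?A = "Poly_Mapping.keys u \<union> Poly_Mapping.keys v"
  have *: "finite ?A" "Poly_Mapping.keys (u + v) \<subseteq> ?A" by (auto simp: keys_add)
  show ?thesis
    by (simp add: lin_extend_superset[OF *] lin_extend_superset[of ?A u]
        lin_extend_superset[of ?A v]
        lookup_add scale_add_left sum.distrib)
qed

lemma lin_extend_scale: "lin_extend f (scale c v) = scale c (lin_extend f v)"
proof -
  have "lin_extend f (scale c v) =
      (\<Sum>k\<in>Poly_Mapping.keys v. scale (Poly_Mapping.lookup (scale c v) k) (f k))"
    by (rule lin_extend_superset) (simp_all add: keys_scale)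
  then show ?thesis by (simp add: lin_extend_def scale_sum)
qed

lemma lin_extend_zero [simp]: "lin_extend f 0 = 0"
  by (simp add: lin_extend_def)

lemma lin_extend_single [simp]: "lin_extend f (Poly_Mapping.single k c) = scale c (f k)"
  by (simp add: lin_extend_def)

lemma keys_lin_extend:
  assumes "\<And>k. k \<in> Poly_Mapping.keys v \<Longrightarrow> Poly_Mapping.keys (f k) \<subseteq> S"
  shows "Poly_Mapping.keys (lin_extend f v) \<subseteq> S"
  unfolding lin_extend_def
  using keys_sum[of "\<lambda>k. scale (Poly_Mapping.lookup v k) (f k)" "Poly_Mapping.keys v"]
    keys_scale[of _ "f _"] assms by fast

section \<open>The free algebra and its quotient by the Hecke relations\<close>

lemma ring_free_algebra: "ring (free_algebra N)"
proof (rule ringI)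
  show "abelian_group (free_algebra N)"
  proof (rule abelian_groupI)
    fix x assume x: "x \<in> carrier (free_algebra N)"
    show "\<exists>y\<in>carrier (free_algebra N). y \<oplus>\<^bsub>free_algebra N\<^esub> x = \<zero>\<^bsub>free_algebra N\<^esub>"
      by (rule bexI[of _ "- x"]) (use x in \<open>auto simp: free_algebra_def in_keys_iff\<close>)
  qed (auto simp: free_algebra_def algebra_simps dest!: subsetD[OF keys_add])
  show "monoid (free_algebra N)"
  proof (rule monoidI)
    fix x y assume "x \<in> carrier (free_algebra N)" "y \<in> carrier (free_algebra N)"
    then show "x \<otimes>\<^bsub>free_algebra N\<^esub> y \<in> carrier (free_algebra N)"
      using keys_mult[of x y] by (fastforce simp: free_algebra_def plus_hword_def)
  qed (auto simp: free_algebra_def mult.assoc zero_hword_def)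
qed (auto simp: free_algebra_def algebra_simps)

interpretation free: ring "free_algebra N" for N
  by (rule ring_free_algebra)

lemma free_algebra_simps [simp]:
  "x \<otimes>\<^bsub>free_algebra N\<^esub> y = x * y" "x \<oplus>\<^bsub>free_algebra N\<^esub> y = x + y"
  "\<one>\<^bsub>free_algebra N\<^esub> = 1" "\<zero>\<^bsub>free_algebra N\<^esub> = 0"
  by (simp_all add: free_algebra_def)

lemma a_inv_free_algebra:
  assumes "x \<in> carrier (free_algebra N)"
  shows "\<ominus>\<^bsub>free_algebra N\<^esub> x = - x"
proof -
  have "- x \<in> carrier (free_algebra N)"
    using assms by (auto simp: free_algebra_def in_keys_iff)
  then show ?thesis using assms by (intro free.minus_equality) auto
qed

lemma diff_in_free_algebra:
  assumes "x \<in> carrier (free_algebra N)" "y \<in> carrier (free_algebra N)"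
  shows "x - y \<in> carrier (free_algebra N)"
  using free.minus_closed[OF assms] by (simp add: a_minus_def a_inv_free_algebra assms)

lemma mult_in_free_algebra:
  assumes "x \<in> carrier (free_algebra N)" "y \<in> carrier (free_algebra N)"
  shows "x * y \<in> carrier (free_algebra N)"
  using free.m_closed[OF assms] by simp

lemma single_in_free_algebra:
  "set (letters w) \<subseteq> {1..<N} \<Longrightarrow> Poly_Mapping.single w c \<in> carrier (free_algebra N)"
  by (auto simp: free_algebra_def)

lemma free_gen_in_free_algebra: "i \<in> {1..<N} \<Longrightarrow> free_gen i \<in> carrier (free_algebra N)"
  by (simp add: free_gen_def single_in_free_algebra)

lemma hecke_relators_closed: "hecke_relators N \<subseteq> carrier (free_algebra N)"
  by (auto simp: hecke_relators_def
      intro!: diff_in_free_algebra mult_in_free_algebra free_gen_in_free_algebra)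

lemma ideal_hecke_ideal: "ideal (hecke_ideal N) (free_algebra N)"
  unfolding hecke_ideal_def by (rule free.genideal_ideal[OF hecke_relators_closed])

lemma ring_hecke: "ring (hecke N)"
  unfolding hecke_def by (rule ideal.quotient_is_ring[OF ideal_hecke_ideal])

lemma hecke_class_hom: "hecke_class N \<in> ring_hom (free_algebra N) (hecke N)"
  unfolding hecke_def hecke_class_def[abs_def] by (rule ideal.rcos_ring_hom[OF ideal_hecke_ideal])

lemma carrier_hecke: "carrier (hecke N) = hecke_class N ` carrier (free_algebra N)"
  by (auto simp: hecke_def FactRing_def A_RCOSETS_def' hecke_class_def)

lemma hecke_class_add:
  "p \<in> carrier (free_algebra N) \<Longrightarrow> q \<in> carrier (free_algebra N) \<Longrightarrow>
    hecke_class N p \<oplus>\<^bsub>hecke N\<^esub> hecke_class N q = hecke_class N (p + q)"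
  using ring_hom_add[OF hecke_class_hom] by simp

lemma hecke_class_mult:
  "p \<in> carrier (free_algebra N) \<Longrightarrow> q \<in> carrier (free_algebra N) \<Longrightarrow>
    hecke_class N p \<otimes>\<^bsub>hecke N\<^esub> hecke_class N q = hecke_class N (p * q)"
  using ring_hom_mult[OF hecke_class_hom] by simp

lemma hecke_class_one: "\<one>\<^bsub>hecke N\<^esub> = hecke_class N 1"
  using ring_hom_one[OF hecke_class_hom] by simp

lemma hecke_class_closed: "p \<in> carrier (free_algebra N) \<Longrightarrow> hecke_class N p \<in> carrier (hecke N)"
  by (simp add: carrier_hecke)

lemma hecke_class_zero: "\<zero>\<^bsub>hecke N\<^esub> = hecke_class N 0"
  using additive_subgroup.a_subset[OF ideal.axioms(1)[OF ideal_hecke_ideal[of N]]]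
    free.a_coset_add_zero[of "hecke_ideal N" N]
  by (simp add: hecke_def FactRing_def hecke_class_def)

lemma hecke_gen_closed: "i \<in> {1..<N} \<Longrightarrow> hecke_gen N i \<in> carrier (hecke N)"
  by (simp add: hecke_gen_def hecke_class_closed free_gen_in_free_algebra)

lemma scalar_in_free_algebra: "Poly_Mapping.single 0 c \<in> carrier (free_algebra N)"
  by (rule single_in_free_algebra) (simp add: zero_hword_def)

lemma hecke_scalar_closed: "hecke_scalar N c \<in> carrier (hecke N)"
  by (simp add: hecke_scalar_def hecke_class_closed scalar_in_free_algebra)

lemma hecke_scalar_zero: "hecke_scalar N 0 = \<zero>\<^bsub>hecke N\<^esub>"
  by (simp add: hecke_scalar_def hecke_class_zero)

lemma hecke_scalar_mult:
  "hecke_scalar N c \<otimes>\<^bsub>hecke N\<^esub> hecke_scalar N d = hecke_scalar N (c * d)"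
  by (simp add: hecke_scalar_def hecke_class_mult scalar_in_free_algebra mult_single)

text \<open>Scalars are multiples of the empty word, which is neutral on both sides. This
  commutation is what makes the action of a generator complex linear.\<close>

lemma hecke_scalar_gen_commute:
  assumes "i \<in> {1..<N}"
  shows "hecke_gen N i \<otimes>\<^bsub>hecke N\<^esub> hecke_scalar N c = hecke_scalar N c \<otimes>\<^bsub>hecke N\<^esub> hecke_gen N i"
  by (simp add: hecke_scalar_def hecke_gen_def hecke_class_mult scalar_in_free_algebra
      free_gen_in_free_algebra[OF assms])
    (simp add: free_gen_def mult_single)

section \<open>From operators for the generators to an action of the free algebra\<close>

fun word_act :: "(nat \<Rightarrow> 'v \<Rightarrow> 'v) \<Rightarrow> nat list \<Rightarrow> 'v \<Rightarrow> 'v" where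
  "word_act op [] v = v"
| "word_act op (i # ws) v = op i (word_act op ws v)"

lemma word_act_append: "word_act op (us @ ws) v = word_act op us (word_act op ws v)"
  by (induction us) auto

definition free_act ::
    "(nat \<Rightarrow> ('b \<Rightarrow>\<^sub>0 complex) \<Rightarrow> ('b \<Rightarrow>\<^sub>0 complex)) \<Rightarrow> free_elem \<Rightarrow> ('b \<Rightarrow>\<^sub>0 complex) \<Rightarrow> ('b \<Rightarrow>\<^sub>0 complex)"
  where "free_act op p v = lin_extend (\<lambda>w. word_act op (letters w) v) p"

lemma free_act_add: "free_act op (p + q) v = free_act op p v + free_act op q v"
  by (simp add: free_act_def lin_extend_add)

lemma free_act_zero [simp]: "free_act op 0 v = 0"
  by (simp add: free_act_def)

lemma free_act_minus: "free_act op (p - q) v = free_act op p v - free_act op q v"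
  by (metis add_diff_cancel diff_add_cancel free_act_add)

lemma free_act_single:
  "free_act op (Poly_Mapping.single w c) v = scale c (word_act op (letters w) v)"
  by (simp add: free_act_def)

lemma free_act_gen [simp]: "free_act op (free_gen i) v = op i v"
  by (simp add: free_gen_def free_act_single)

lemma free_act_scalar: "free_act op (Poly_Mapping.single 0 c) v = scale c v"
  by (simp add: free_act_single zero_hword_def)

lemma free_act_one: "free_act op 1 v = v"
  by (metis free_act_scalar scale_one single_one)

locale linear_operators =
  fixes op :: "nat \<Rightarrow> ('b \<Rightarrow>\<^sub>0 complex) \<Rightarrow> ('b \<Rightarrow>\<^sub>0 complex)"
  assumes op_add: "op i (u + v) = op i u + op i v"
    and op_scale: "op i (scale c v) = scale c (op i v)"
begin

lemma word_act_add: "word_act op ws (u + v) = word_act op ws u + word_act op ws v"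
  by (induction ws) (auto simp: op_add)

lemma word_act_scale: "word_act op ws (scale c v) = scale c (word_act op ws v)"
  by (induction ws) (auto simp: op_scale)

lemma free_act_add_right: "free_act op p (u + v) = free_act op p u + free_act op p v"
  by (simp add: free_act_def lin_extend_def word_act_add scale_add_right sum.distrib)

lemma free_act_scale_right: "free_act op p (scale c v) = scale c (free_act op p v)"
  by (simp add: free_act_def lin_extend_def word_act_scale scale_sum mult.commute)

lemma free_act_zero_right [simp]: "free_act op p 0 = 0"
  using free_act_scale_right[of p 0 0] by simp

text \<open>Both sides are additive in \<open>p\<close> and \<open>q\<close>, so it suffices to take
  multiples of words, where concatenation is composition. Linearity of the operators lets the
  coefficient of the second word pass through the first.\<close>

lemma free_act_mult: "free_act op (p * q) v = free_act op p (free_act op q v)"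
proof (induction p rule: poly_mapping_single_induct)
  case (single w)
  show ?case
  proof (induction q rule: poly_mapping_single_induct)
    case (single u)
    show ?case
      by (simp add: mult_single free_act_single plus_hword_def word_act_append word_act_scale)
  qed (simp_all add: distrib_left free_act_add free_act_add_right)
qed (simp_all add: distrib_right free_act_add)

end

definition span_module ::
    "'b set \<Rightarrow> (free_elem set \<Rightarrow> ('b \<Rightarrow>\<^sub>0 complex) \<Rightarrow> ('b \<Rightarrow>\<^sub>0 complex)) \<Rightarrow>
     (free_elem set, 'b \<Rightarrow>\<^sub>0 complex) module" where
  "span_module S act =
    \<lparr>carrier = {v. Poly_Mapping.keys v \<subseteq> S}, mult = undefined, one = undefined,
     zero = 0, add = (+), smult = act\<rparr>"

lemma span_module_simps [simp]:
  "carrier (span_module S act) = {v. Poly_Mapping.keys v \<subseteq> S}"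
  "\<zero>\<^bsub>span_module S act\<^esub> = 0" "u \<oplus>\<^bsub>span_module S act\<^esub> v = u + v"
  "X \<odot>\<^bsub>span_module S act\<^esub> v = act X v"
  by (simp_all add: span_module_def)

lemma abelian_group_span_module: "abelian_group (span_module S act)"
proof (rule abelian_groupI)
  fix x assume "x \<in> carrier (span_module S act)"
  then show "\<exists>y\<in>carrier (span_module S act). y \<oplus>\<^bsub>span_module S act\<^esub> x = \<zero>\<^bsub>span_module S act\<^esub>"
    by (intro bexI[of _ "- x"]) (auto simp: in_keys_iff)
qed (auto simp: algebra_simps dest!: subsetD[OF keys_add])

text \<open>\<open>act\<close> is constrained only on vectors supported in \<open>S\<close>;
  elsewhere it may be anything. The operators \<open>op\<close> are total and linear, so
  calculations are done with them and carried over to \<open>act\<close> on the span.\<close>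

locale hecke_representation = linear_operators op
  for op :: "nat \<Rightarrow> ('b \<Rightarrow>\<^sub>0 complex) \<Rightarrow> ('b \<Rightarrow>\<^sub>0 complex)" +
  fixes N :: nat and S :: "'b set"
    and act :: "free_elem set \<Rightarrow> ('b \<Rightarrow>\<^sub>0 complex) \<Rightarrow> ('b \<Rightarrow>\<^sub>0 complex)"
  assumes op_closed: "\<lbrakk>i \<in> {1..<N}; Poly_Mapping.keys v \<subseteq> S\<rbrakk> \<Longrightarrow> Poly_Mapping.keys (op i v) \<subseteq> S"
    and left_module_act: "left_module (hecke N) (span_module S act)"
    and act_scalar: "Poly_Mapping.keys v \<subseteq> S \<Longrightarrow> act (hecke_scalar N c) v = scale c v"
    and act_gen: "\<lbrakk>i \<in> {1..<N}; Poly_Mapping.keys v \<subseteq> S\<rbrakk> \<Longrightarrow> act (hecke_gen N i) v = op i v"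

context linear_operators
begin

context
  fixes N :: nat and S :: "'b set"
  assumes closed: "\<And>i v. \<lbrakk>i \<in> {1..<N}; Poly_Mapping.keys v \<subseteq> S\<rbrakk> \<Longrightarrow> Poly_Mapping.keys (op i v) \<subseteq> S"
begin

lemma word_act_closed:
  "set ws \<subseteq> {1..<N} \<Longrightarrow> Poly_Mapping.keys v \<subseteq> S \<Longrightarrow> Poly_Mapping.keys (word_act op ws v) \<subseteq> S"
  by (induction ws) (auto simp: closed)

lemma free_act_closed:
  "p \<in> carrier (free_algebra N) \<Longrightarrow> Poly_Mapping.keys v \<subseteq> S \<Longrightarrow>
    Poly_Mapping.keys (free_act op p v) \<subseteq> S"
  unfolding free_act_def
  by (intro keys_lin_extend word_act_closed) (auto simp: free_algebra_def)

lemma hecke_representation_exists: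
  assumes idem: "\<And>i v. \<lbrakk>i \<in> {1..<N}; Poly_Mapping.keys v \<subseteq> S\<rbrakk> \<Longrightarrow> op i (op i v) = op i v"
    and braid: "\<And>i v. \<lbrakk>i \<in> {1..<N}; i + 1 \<in> {1..<N}; Poly_Mapping.keys v \<subseteq> S\<rbrakk> \<Longrightarrow>
      op i (op (i + 1) (op i v)) = op (i + 1) (op i (op (i + 1) v))"
    and commute: "\<And>i j v. \<lbrakk>i \<in> {1..<N}; j \<in> {1..<N}; i + 2 \<le> j; Poly_Mapping.keys v \<subseteq> S\<rbrakk> \<Longrightarrow>
      op i (op j v) = op j (op i v)"
  shows "\<exists>act. hecke_representation op N S act"
proof -
  \<comment> \<open>The annihilator of the span. It absorbs factors on the right as well, because
    the span is invariant under the free algebra; so it contains \<open>hecke_ideal\<close> once it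
    contains the relators.\<close>
  define K where "K =
    {p \<in> carrier (free_algebra N). \<forall>v. Poly_Mapping.keys v \<subseteq> S \<longrightarrow> free_act op p v = 0}"
  have "ideal K (free_algebra N)"
  proof (rule idealI[OF ring_free_algebra])
    show "subgroup K (add_monoid (free_algebra N))"
    proof (rule free.add.subgroupI)
      show "\<ominus>\<^bsub>free_algebra N\<^esub> p \<in> K" if "p \<in> K" for p
        using that diff_in_free_algebra[OF free.zero_closed, of p N] free_act_minus[of op 0 p]
        by (auto simp: K_def a_inv_free_algebra)
      show "K \<noteq> {}" using free.zero_closed by (force simp: K_def)
    qed (use free.a_closed in \<open>auto simp: K_def free_act_add\<close>)
  qed (auto simp: K_def mult_in_free_algebra free_act_mult free_act_closed)
  moreover have "hecke_relators N \<subseteq> K"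
  proof
    fix p assume p: "p \<in> hecke_relators N"
    have "free_act op p v = 0" if "Poly_Mapping.keys v \<subseteq> S" for v
      using p unfolding hecke_relators_def
    proof (elim UnE CollectE exE conjE)
      fix i j assume ij: "i \<in> {1..<N}" "j \<in> {1..<N}" "i + 2 \<le> j \<or> j + 2 \<le> i"
        and p: "p = free_gen i * free_gen j - free_gen j * free_gen i"
      show ?thesis
        using commute[of i j, OF _ _ _ that] commute[of j i, OF _ _ _ that] ij
        by (auto simp: p free_act_minus free_act_mult)
    qed (simp_all add: free_act_minus free_act_mult idem that braid[simplified])
    then show "p \<in> K" using p hecke_relators_closed by (auto simp: K_def)
  qed
  ultimately have ideal_K: "hecke_ideal N \<subseteq> K"
    unfolding hecke_ideal_def by (rule free.genideal_minimal)
  \<comment> \<open>Any representative serves: two of them differ by an element of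
    \<open>hecke_ideal\<close>, which lies in \<open>K\<close> and hence acts as zero on the
    span.\<close>
  define act where "act X v = free_act op (SOME p. p \<in> X) v" for X v
  have act: "act (hecke_class N p) v = free_act op p v"
    if p: "p \<in> carrier (free_algebra N)" and v: "Poly_Mapping.keys v \<subseteq> S" for p v
  proof -
    have "p \<in> hecke_class N p"
      unfolding hecke_class_def 
      by (rule abelian_subgroup.a_rcos_self[OF abelian_subgroupI3[OF
            ideal.axioms(1)[OF ideal_hecke_ideal] free.abelian_group_axioms] p])
    then have "(SOME q. q \<in> hecke_class N p) \<in> hecke_class N p" by (rule someI)
    then obtain h where h: "h \<in> hecke_ideal N" "(SOME q. q \<in> hecke_class N p) = h + p"
      by (auto simp: hecke_class_def a_r_coset_def')
    then have "free_act op h v = 0" using ideal_K v by (auto simp: K_def)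
    then show ?thesis by (simp add: act_def h free_act_add)
  qed
  have sum_closed: "Poly_Mapping.keys (u + v) \<subseteq> S"
    if "Poly_Mapping.keys u \<subseteq> S" "Poly_Mapping.keys v \<subseteq> S" for u v :: "'b \<Rightarrow>\<^sub>0 complex"
    using that keys_add[of u v] by auto
  have "left_module (hecke N) (span_module S act)"
    unfolding left_module_def left_module_axioms_def
    using ring_hecke abelian_group_span_module free.a_closed free.one_closed[of N]
    by (auto simp: carrier_hecke hecke_class_one hecke_class_add hecke_class_mult
        act mult_in_free_algebra free_act_add free_act_mult free_act_one
        free_act_add_right free_act_closed free_act_closed[THEN subsetD] sum_closed)
  then have "hecke_representation op N S act"
    by (intro hecke_representation.intro hecke_representation_axioms.intro linear_operators_axioms)
      (auto simp: closed[simplified] hecke_scalar_def hecke_gen_def act scalar_in_free_algebra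
        free_gen_in_free_algebra free_act_scalar)
  then show ?thesis by (rule exI[of _ act])
qed

end

end

context hecke_representation
begin

sublocale left_module "hecke N" "span_module S act"
  by (rule left_module_act)

text \<open>Uniqueness of the action: scalars and generators generate the algebra, so their
  prescribed values determine \<open>act\<close> on the span, on words by induction and then on
  linear combinations.\<close>

lemma act_class:
  assumes v: "Poly_Mapping.keys v \<subseteq> S" and p: "p \<in> carrier (free_algebra N)"
  shows "act (hecke_class N p) v = free_act op p v"
proof -
  have word: "act (hecke_class N (Poly_Mapping.single (HWord ws) 1)) v = word_act op ws v"
    if "set ws \<subseteq> {1..<N}" for ws
    using that
  proof (induction ws)
    case Nil
    then show ?case
      using smult_one[of v] v by (simp add: hecke_class_one zero_hword_def[symmetric])
  next
    case (Cons i ws)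
    have *: "Poly_Mapping.single (HWord (i # ws)) 1
      = free_gen i * (Poly_Mapping.single (HWord ws) 1 :: free_elem)"
      by (simp add: free_gen_def mult_single plus_hword_def)
    have "Poly_Mapping.keys (word_act op ws v) \<subseteq> S"
      using word_act_closed[OF op_closed] Cons.prems v by auto
    then show ?case
      using Cons smult_assoc1[of "hecke_gen N i"
          "hecke_class N (Poly_Mapping.single (HWord ws) 1)" v] v
      by (simp add: * hecke_gen_def hecke_class_mult[symmetric] hecke_class_closed
          free_gen_in_free_algebra single_in_free_algebra act_gen[unfolded hecke_gen_def])
  qed
  \<comment> \<open>Membership in the free algebra is carried through the induction, since
    additivity of \<open>hecke_class\<close> requires it of both summands.\<close>
  have "p \<in> carrier (free_algebra N) \<and> act (hecke_class N p) v = free_act op p v"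
  proof (induction p rule: poly_mapping_single_induct)
    case zero
    then show ?case
      using act_scalar[OF v, of 0] free.zero_closed[of N] by (simp add: hecke_scalar_def)
  next
    case (single w)
    let ?c = "Poly_Mapping.lookup p w"
    have w: "set (letters w) \<subseteq> {1..<N}" using p single by (auto simp: free_algebra_def)
    have wc: "Poly_Mapping.keys (word_act op (letters w) v) \<subseteq> S"
      by (rule word_act_closed[OF op_closed]) (use w v in auto)
    have *: "Poly_Mapping.single w ?c = Poly_Mapping.single 0 ?c * Poly_Mapping.single w 1"
      by (simp add: mult_single)
    have "act (hecke_class N (Poly_Mapping.single w ?c)) v
        = act (hecke_scalar N ?c) (act (hecke_class N (Poly_Mapping.single w 1)) v)"
      using smult_assoc1[of "hecke_scalar N ?c" "hecke_class N (Poly_Mapping.single w 1)" v] v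
      by (subst *) (simp add: hecke_class_mult[symmetric] hecke_scalar_def hecke_class_closed
          scalar_in_free_algebra single_in_free_algebra[OF w, simplified])
    then show ?case
      using word[OF w] act_scalar[OF wc] w
      by (simp add: free_act_single single_in_free_algebra)
  next
    case (add f g)
    then show ?case
      using free.a_closed[of f N g] smult_l_distr[of "hecke_class N f" "hecke_class N g" v] v
      by (simp add: hecke_class_closed hecke_class_add free_act_add)
  qed
  then show ?thesis by simp
qed

text \<open>By \<open>act_class\<close> every algebra element acts as a combination of words in the
  operators, so stability under the generators gives stability under the whole algebra.\<close>

lemma submoduleI:
  assumes sub: "\<And>v. v \<in> U \<Longrightarrow> Poly_Mapping.keys v \<subseteq> S" and zero: "0 \<in> U"
    and add: "\<And>u v. u \<in> U \<Longrightarrow> v \<in> U \<Longrightarrow> u + v \<in> U"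
    and scale: "\<And>c v. v \<in> U \<Longrightarrow> scale c v \<in> U"
    and gen: "\<And>i v. i \<in> {1..<N} \<Longrightarrow> v \<in> U \<Longrightarrow> op i v \<in> U"
  shows "submodule U (hecke N) (span_module S act)"
proof -
  have word: "word_act op ws v \<in> U" if "set ws \<subseteq> {1..<N}" "v \<in> U" for ws v
    using that by (induction ws) (auto intro: gen)
  have free: "free_act op p v \<in> U" if "p \<in> carrier (free_algebra N)" and v: "v \<in> U" for p v
  proof (induction p rule: poly_mapping_single_induct)
    case (single w)
    then have "set (letters w) \<subseteq> {1..<N}" using that by (auto simp: free_algebra_def)
    then show ?case using v by (simp add: free_act_single scale word)
  qed (auto simp: zero add free_act_add)
  have inv: "\<ominus>\<^bsub>span_module S act\<^esub> v \<in> U" if "v \<in> U" for v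
  proof -
    have "- v \<in> U" using scale[OF that, of "- 1"] by (simp add: scale_minus_one)
    moreover from this have "\<ominus>\<^bsub>span_module S act\<^esub> v = - v"
      by (intro M.minus_equality) (use sub that in auto)
    ultimately show ?thesis by simp
  qed
  have "subgroup U (add_monoid (span_module S act))"
    by (rule M.add.subgroupI) (use sub zero add inv in auto)
  then show ?thesis
    by (auto simp: submodule_def submodule_axioms_def carrier_hecke act_class sub free)
qed

lemma submoduleD:
  assumes "submodule U (hecke N) (span_module S act)"
  shows "\<And>v. v \<in> U \<Longrightarrow> Poly_Mapping.keys v \<subseteq> S" and "0 \<in> U"
    and "\<And>u v. u \<in> U \<Longrightarrow> v \<in> U \<Longrightarrow> u + v \<in> U"
    and "\<And>c v. v \<in> U \<Longrightarrow> scale c v \<in> U"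
    and "\<And>u v. u \<in> U \<Longrightarrow> v \<in> U \<Longrightarrow> u - v \<in> U"
    and "\<And>i v. i \<in> {1..<N} \<Longrightarrow> v \<in> U \<Longrightarrow> op i v \<in> U"
proof -
  interpret U: submodule U "hecke N" "span_module S act" by fact
  show sub: "Poly_Mapping.keys v \<subseteq> S" if "v \<in> U" for v using that U.subset by auto
  show "0 \<in> U" using U.one_closed by simp
  show add: "u + v \<in> U" if "u \<in> U" "v \<in> U" for u v using U.m_closed[OF that] by simp
  show scale: "scale c v \<in> U" if "v \<in> U" for c v
    using U.smult_closed[OF hecke_scalar_closed that, of c] act_scalar[OF sub[OF that]] by simp
  show "u - v \<in> U" if "u \<in> U" "v \<in> U" for u v
    using add[OF that(1) scale[OF that(2), of "- 1"]] by (simp add: scale_minus_one)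
  show "op i v \<in> U" if "i \<in> {1..<N}" "v \<in> U" for i v
    using U.smult_closed[OF hecke_gen_closed[OF that(1)] that(2)] act_gen[OF that(1) sub[OF that(2)]]
    by simp
qed

end

text \<open>The values of a generator are prescribed on basis vectors only. Scalars act through the
  algebra and commute with the generator, so the module axioms force its action to be complex
  linear.\<close>

lemma act_gen_lin_extend:
  assumes "left_module (hecke N) (span_module S act)"
    and scalar: "\<And>c v. Poly_Mapping.keys v \<subseteq> S \<Longrightarrow> act (hecke_scalar N c) v = scale c v"
    and gen: "\<And>T. T \<in> S \<Longrightarrow> act (hecke_gen N i) (Poly_Mapping.single T 1) = f T"
    and i: "i \<in> {1..<N}" and v: "Poly_Mapping.keys v \<subseteq> S"
  shows "act (hecke_gen N i) v = lin_extend f v"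
proof -
  interpret left_module "hecke N" "span_module S act" by fact
  have "Poly_Mapping.keys v \<subseteq> S \<and> act (hecke_gen N i) v = lin_extend f v"
  proof (induction v rule: poly_mapping_single_induct)
    case zero
    then show ?case using smult_zero[OF hecke_gen_closed[OF i]] by simp
  next
    case (single T)
    let ?c = "Poly_Mapping.lookup v T"
    let ?e = "Poly_Mapping.single T 1 :: 'a \<Rightarrow>\<^sub>0 complex"
    have T: "T \<in> S" using single v by auto
    have e: "Poly_Mapping.single T ?c = act (hecke_scalar N ?c) ?e"
      using scalar[of ?e] T by simp
    have "Poly_Mapping.keys (act (hecke_gen N i) ?e) \<subseteq> S"
      using smult_closed[OF hecke_gen_closed[OF i], of ?e] T by simp
    then have act: "act (hecke_gen N i) (Poly_Mapping.single T ?c)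
        = scale ?c (act (hecke_gen N i) ?e)"
      using smult_assoc1[OF hecke_gen_closed[OF i] hecke_scalar_closed, of ?e ?c]
        smult_assoc1[OF hecke_scalar_closed hecke_gen_closed[OF i], of ?e ?c]
        hecke_scalar_gen_commute[OF i, of ?c] scalar T
      by (simp add: e del: map_single)
    show ?case using T by (simp add: act gen del: map_single)
  next
    case (add u w)
    then show ?case
      using smult_r_distr[OF hecke_gen_closed[OF i], of u w] keys_add[of u w]
      by (auto simp: lin_extend_add)
  qed
  then show ?thesis by simp
qed

section \<open>Compositions and one-dimensional factors\<close>

lemma set_of_comp_Nil [simp]: "set_of_comp [] = {}"
  by (simp add: set_of_comp_def)

lemma set_of_comp_Cons:
  "set_of_comp (a # \<gamma>) = (if \<gamma> = [] then {} else insert a ((+) a ` set_of_comp \<gamma>))"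
proof (cases "\<gamma> = []")
  case False
  have "x \<in> set_of_comp (a # \<gamma>) \<longleftrightarrow> x \<in> insert a ((+) a ` set_of_comp \<gamma>)" for x
  proof
    assume "x \<in> set_of_comp (a # \<gamma>)"
    then obtain i where i: "x = sum_list (take i (a # \<gamma>))" "1 \<le> i" "i < length (a # \<gamma>)"
      by (auto simp: set_of_comp_def)
    then obtain k where k: "i = Suc k" by (cases i) auto
    show "x \<in> insert a ((+) a ` set_of_comp \<gamma>)"
    proof (cases "k = 0")
      case False
      then have "sum_list (take k \<gamma>) \<in> set_of_comp \<gamma>"
        using i k unfolding set_of_comp_def by (intro CollectI exI[of _ k]) auto
      then show ?thesis using i k by simp
    qed (use i k in simp)
  next
    assume "x \<in> insert a ((+) a ` set_of_comp \<gamma>)"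
    then consider "x = a"
      | i where "x = a + sum_list (take i \<gamma>)" "1 \<le> i" "i < length \<gamma>"
      by (auto simp: set_of_comp_def)
    then show "x \<in> set_of_comp (a # \<gamma>)"
    proof cases
      case 1
      then show ?thesis using False by (auto simp: set_of_comp_def intro!: exI[of _ 1])
    next
      case 2
      then show ?thesis by (auto simp: set_of_comp_def intro!: exI[of _ "Suc i"])
    qed
  qed
  then show ?thesis using False by auto
qed (auto simp: set_of_comp_def)

lemma composition_Cons: "composition N (a # \<gamma>) \<longleftrightarrow> 0 < a \<and> a \<le> N \<and> composition (N - a) \<gamma>"
  by (auto simp: composition_def)

lemma set_of_comp_bounds:
  assumes "composition N \<gamma>"
  shows "set_of_comp \<gamma> \<subseteq> {1..<N}"
  using assms
proof (induction \<gamma> arbitrary: N)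
  case (Cons a \<gamma>)
  have "N - a \<noteq> 0" if "\<gamma> \<noteq> []"
    using Cons.prems that by (cases \<gamma>) (auto simp: composition_def)
  moreover have "set_of_comp \<gamma> \<subseteq> {1..<N - a}"
    using Cons by (simp add: composition_Cons)
  ultimately show ?case
    using Cons.prems by (auto simp: set_of_comp_Cons composition_Cons subset_iff)
qed auto

text \<open>The first part is the least proper partial sum, so it can be read off; the remaining
  partial sums are those of the tail, shifted by it.\<close>

lemma set_of_comp_inj:
  assumes "composition N \<gamma>" "composition N \<gamma>'" "set_of_comp \<gamma> = set_of_comp \<gamma>'"
  shows "\<gamma> = \<gamma>'"
  using assms
proof (induction \<gamma> arbitrary: N \<gamma>')
  case Nil
  then show ?case by (cases \<gamma>') (auto simp: composition_def)
next
  case (Cons a \<gamma>)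
  then obtain b \<delta> where \<gamma>': "\<gamma>' = b # \<delta>" by (cases \<gamma>') (auto simp: composition_def)
  show ?case
  proof (cases "\<gamma> = [] \<or> \<delta> = []")
    case True
    then have "\<gamma> = []" "\<delta> = []" using Cons.prems(3)
      by (auto simp: \<gamma>' set_of_comp_Cons split: if_splits)
    then show ?thesis using Cons.prems by (simp add: \<gamma>' composition_def)
  next
    case False
    have least: "x \<noteq> c" "c \<le> c + x" if "x \<in> (+) c ` set_of_comp \<epsilon>" "composition M \<epsilon>" for x c M \<epsilon>
      using that set_of_comp_bounds[of M \<epsilon>] by auto
    have comps: "composition (N - a) \<gamma>" "composition (N - b) \<delta>"
      using Cons.prems by (auto simp: \<gamma>' composition_Cons)
    have eq: "insert a ((+) a ` set_of_comp \<gamma>) = insert b ((+) b ` set_of_comp \<delta>)"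
      using Cons.prems(3) False by (simp add: \<gamma>' set_of_comp_Cons)
    have "a \<in> insert b ((+) b ` set_of_comp \<delta>)" "b \<in> insert a ((+) a ` set_of_comp \<gamma>)"
      using eq by blast+
    then have ab: "a = b" by auto
    \<comment> \<open>Partial sums of the tails are positive, so the inserted element can be
      cancelled from both sides of \<open>eq\<close>.\<close>
    have "a \<notin> (+) a ` set_of_comp \<gamma>" "a \<notin> (+) a ` set_of_comp \<delta>"
      using least(1) comps by blast+
    then have "(+) a ` set_of_comp \<gamma> = (+) a ` set_of_comp \<delta>"
      using eq insert_ident[of a] unfolding ab[symmetric] by simp
    then have "set_of_comp \<gamma> = set_of_comp \<delta>"
      by (simp add: inj_image_eq_iff)
    then show ?thesis using Cons.IH[OF comps(1), of \<delta>] comps ab \<gamma>' by simp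
  qed
qed

text \<open>The sum telescopes; sortedness keeps the subtraction of natural numbers from
  truncating.\<close>

lemma sum_list_take_differences:
  fixes xs :: "nat list"
  assumes "sorted xs" "k < length xs"
  shows "sum_list (take (Suc k) (map2 (-) xs (0 # butlast xs))) = xs ! k"
  using assms(2)
proof (induction k)
  case 0
  then show ?case by (cases xs) auto
next
  case (Suc k)
  let ?d = "map2 (-) xs (0 # butlast xs)"
  have "sum_list (take (Suc (Suc k)) ?d) = sum_list (take (Suc k) ?d) + ?d ! Suc k"
    using Suc.prems by (subst take_Suc_conv_app_nth) auto
  also have "\<dots> = xs ! k + (xs ! Suc k - xs ! k)"
    using Suc by (simp add: nth_butlast)
  also have "\<dots> = xs ! Suc k"
    using sorted_nth_mono[OF assms(1), of k "Suc k"] Suc.prems by simp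
  finally show ?case .
qed

lemma
  assumes "D \<subseteq> {1..<N}"
  shows composition_comp_of_set: "composition N (comp_of_set N D)"
    and set_of_comp_of_set: "set_of_comp (comp_of_set N D) = D"
proof -
  have fin: "finite D" using assms finite_subset by blast
  \<comment> \<open>The entries of \<open>xs\<close> become the partial sums of the composition: the
    appended \<open>N\<close> is the total, the other entries are the elements of
    \<open>D\<close>.\<close>
  define xs where "xs = sorted_list_of_set D @ [N]"
  have xs: "sorted_wrt (<) xs" "set (butlast xs) = D" "xs \<noteq> []" "last xs = N"
    using assms fin by (auto simp: xs_def sorted_wrt_append
        sorted_list_of_set.strict_sorted_key_list_of_set)
  have comp: "comp_of_set N D = map2 (-) xs (0 # butlast xs)" if "N \<noteq> 0"
    using that by (simp add: comp_of_set_def xs_def Let_def)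
  have len: "length (map2 (-) xs (0 # butlast xs)) = length xs" using xs(3) by simp
  note partial = sum_list_take_differences[OF strict_sorted_imp_sorted[OF xs(1)]]
  have "composition N (comp_of_set N D) \<and> set_of_comp (comp_of_set N D) = D"
  proof (cases "N = 0")
    case True
    then show ?thesis using assms by (auto simp: comp_of_set_def composition_def)
  next
    case False
    have "0 < map2 (-) xs (0 # butlast xs) ! k" if "k < length xs" for k
    proof (cases k)
      case 0
      then have "xs ! 0 \<in> set xs" using that by simp
      then have "0 < xs ! 0" using assms fin False by (auto simp: xs_def)
      then show ?thesis using 0 that by simp
    next
      case (Suc j)
      then show ?thesis
        using that sorted_wrt_nth_less[OF xs(1), of j k] by (simp add: nth_butlast)
    qed
    then have "\<forall>a\<in>set (map2 (-) xs (0 # butlast xs)). 0 < a"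
      by (metis in_set_conv_nth len)
    moreover have "sum_list (map2 (-) xs (0 # butlast xs)) = N"
      using partial[of "length xs - 1"] xs(3,4) len by (simp add: last_conv_nth)
    moreover have "set_of_comp (map2 (-) xs (0 # butlast xs)) = D"
    proof -
      have "set_of_comp (map2 (-) xs (0 # butlast xs)) = {xs ! (i - 1) |i. 1 \<le> i \<and> i < length xs}"
        unfolding set_of_comp_def len
        by (intro Collect_cong ex_cong)
          (use partial in \<open>metis Suc_pred' less_imp_diff_less less_le_trans zero_less_one\<close>)
      also have "\<dots> = {butlast xs ! k |k. k < length (butlast xs)}"
      proof (intro equalityI subsetI)
        fix x assume "x \<in> {xs ! (i - 1) |i. 1 \<le> i \<and> i < length xs}"
        then obtain i where "x = xs ! (i - 1)" "1 \<le> i" "i < length xs" by blast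
        then show "x \<in> {butlast xs ! k |k. k < length (butlast xs)}"
          by (intro CollectI exI[of _ "i - 1"]) (simp add: nth_butlast)
      next
        fix x assume "x \<in> {butlast xs ! k |k. k < length (butlast xs)}"
        then obtain k where "x = butlast xs ! k" "k < length (butlast xs)" by blast
        then show "x \<in> {xs ! (i - 1) |i. 1 \<le> i \<and> i < length xs}"
          by (intro CollectI exI[of _ "Suc k"]) (simp add: nth_butlast)
      qed
      also have "\<dots> = D" using xs(2) by (auto simp: set_conv_nth)
      finally show ?thesis .
    qed
    ultimately show ?thesis by (simp add: comp[OF False] composition_def)
  qed
  then show "composition N (comp_of_set N D)" "set_of_comp (comp_of_set N D) = D" by auto
qed

lemma finite_compositions: "finite {\<gamma>. composition N \<gamma>}"
proof -
  have "length \<gamma> \<le> sum_list \<gamma>" if "\<forall>a\<in>set \<gamma>. 0 < a" for \<gamma> :: "nat list"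
    using that by (induction \<gamma>) auto
  then have "{\<gamma>. composition N \<gamma>} \<subseteq> {\<gamma>. set \<gamma> \<subseteq> {..N} \<and> length \<gamma> \<le> N}"
    by (auto simp: composition_def member_le_sum_list)
  then show ?thesis using finite_lists_length_le[of "{..N}" N] finite_subset by blast
qed

section \<open>One-dimensional modules as factors\<close>

lemma simple_module_submodule:
  "\<lbrakk>simple_module R M; submodule U R M; U \<noteq> {\<zero>\<^bsub>M\<^esub>}\<rbrakk> \<Longrightarrow> U = carrier M"
  by (auto simp: simple_module_def)

text \<open>Every nonzero element is a multiple of \<open>v\<close> by some
  \<open>c \<noteq> 0\<close>, and multiplication by \<open>d / c\<close> leads from it to any other
  multiple of \<open>v\<close>.\<close>

lemma is_L_simple:
  assumes "is_L N \<gamma> Q"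
  shows "simple_module (hecke N) Q"
proof -
  from assms interpret Q: left_module "hecke N" Q by (simp add: is_L_def)
  obtain v where v: "v \<in> carrier Q" "v \<noteq> \<zero>\<^bsub>Q\<^esub>"
    "carrier Q = {hecke_scalar N c \<odot>\<^bsub>Q\<^esub> v | c. True}"
    using assms by (auto simp: is_L_def)
  have "U = carrier Q" if U: "submodule U (hecke N) Q" "U \<noteq> {\<zero>\<^bsub>Q\<^esub>}" for U
  proof
    interpret U: submodule U "hecke N" Q by fact
    show sub: "U \<subseteq> carrier Q" using U.subset by simp
    obtain x where x: "x \<in> U" "x \<noteq> \<zero>\<^bsub>Q\<^esub>" using U.one_closed U(2) by auto
    then obtain c where c: "x = hecke_scalar N c \<odot>\<^bsub>Q\<^esub> v" using sub v by auto
    with x(2) Q.zero_smult[OF v(1)] have "c \<noteq> 0" by (auto simp: hecke_scalar_zero)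
    show "carrier Q \<subseteq> U"
    proof
      fix y assume "y \<in> carrier Q"
      then obtain d where "y = hecke_scalar N d \<odot>\<^bsub>Q\<^esub> v" using v by auto
      also have "hecke_scalar N d = hecke_scalar N (d / c) \<otimes>\<^bsub>hecke N\<^esub> hecke_scalar N c"
        using \<open>c \<noteq> 0\<close> by (simp add: hecke_scalar_mult)
      also have "\<dots> \<odot>\<^bsub>Q\<^esub> v = hecke_scalar N (d / c) \<odot>\<^bsub>Q\<^esub> x"
        using v c by (simp add: Q.smult_assoc1 hecke_scalar_closed)
      finally show "y \<in> U" using U.smult_closed x hecke_scalar_closed by metis
    qed
  qed
  then show ?thesis
    unfolding simple_module_def using Q.left_module_axioms v(1,2) by auto
qed

text \<open>The two hypotheses may use different spanning vectors. Since generators commute with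
  scalars, a generator that kills one spanning vector kills the whole module, so the set of
  vanishing generators does not depend on the choice.\<close>

lemma is_L_unique:
  assumes "is_L N \<gamma> Q" "is_L N \<gamma>' Q" "composition N \<gamma>" "composition N \<gamma>'"
  shows "\<gamma> = \<gamma>'"
proof -
  from assms interpret Q: left_module "hecke N" Q by (simp add: is_L_def)
  have *: "i \<in> set_of_comp \<delta>'"
    if L: "is_L N \<delta> Q" "is_L N \<delta>' Q" "i \<in> set_of_comp \<delta>" "i \<in> {1..<N}" for i \<delta> \<delta>'
  proof (rule ccontr)
    assume ni: "i \<notin> set_of_comp \<delta>'"
    obtain v where v: "v \<in> carrier Q" "carrier Q = {hecke_scalar N c \<odot>\<^bsub>Q\<^esub> v | c. True}"
      "hecke_gen N i \<odot>\<^bsub>Q\<^esub> v = (if i \<in> set_of_comp \<delta> then \<zero>\<^bsub>Q\<^esub> else v)"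
      using L(1,4) unfolding is_L_def by blast
    obtain v' where v': "v' \<in> carrier Q" "v' \<noteq> \<zero>\<^bsub>Q\<^esub>"
      "hecke_gen N i \<odot>\<^bsub>Q\<^esub> v' = (if i \<in> set_of_comp \<delta>' then \<zero>\<^bsub>Q\<^esub> else v')"
      using L(2,4) unfolding is_L_def by blast
    obtain c where "v' = hecke_scalar N c \<odot>\<^bsub>Q\<^esub> v" using v v' by auto
    then have "v' = hecke_scalar N c \<odot>\<^bsub>Q\<^esub> (hecke_gen N i \<odot>\<^bsub>Q\<^esub> v)"
      using v' ni v(1) L(4) hecke_scalar_gen_commute[OF L(4), of c]
      by (metis Q.smult_assoc1 hecke_gen_closed hecke_scalar_closed)
    then show False using v(3) v'(2) L(3) by (simp add: Q.smult_zero hecke_scalar_closed)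
  qed
  have "set_of_comp \<gamma> = set_of_comp \<gamma>'"
    using *[OF assms(1,2)] *[OF assms(2,1)] set_of_comp_bounds assms(3,4) by blast
  then show ?thesis using set_of_comp_inj assms by blast
qed

lemma coset_eq_image:
  "U +>\<^bsub>span_module S act\<lparr>carrier := W\<rparr>\<^esub> x = (\<lambda>u. u + x) ` U"
  by (auto simp: a_r_coset_def' span_module_def)

context hecke_representation
begin

abbreviation V :: "(free_elem set, 'b \<Rightarrow>\<^sub>0 complex) module" where "V \<equiv> span_module S act"

lemma coset_eq_iff:
  assumes "submodule U (hecke N) V"
  shows "(\<lambda>u. u + x) ` U = (\<lambda>u. u + y) ` U \<longleftrightarrow> x - y \<in> U"
proof
  assume "(\<lambda>u. u + x) ` U = (\<lambda>u. u + y) ` U"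
  then have "0 + x \<in> (\<lambda>u. u + y) ` U" using submoduleD(2)[OF assms] by blast
  then show "x - y \<in> U" by auto
next
  assume *: "x - y \<in> U"
  have "u + x \<in> (\<lambda>u. u + y) ` U" if "u \<in> U" for u
    using submoduleD(3)[OF assms that *] by (intro image_eqI[of _ _ "u + (x - y)"]) auto
  moreover have "u + y \<in> (\<lambda>u. u + x) ` U" if "u \<in> U" for u
    using submoduleD(5)[OF assms that *] by (intro image_eqI[of _ _ "u - (x - y)"]) auto
  ultimately show "(\<lambda>u. u + x) ` U = (\<lambda>u. u + y) ` U" by blast
qed

context
  fixes U W
  assumes U: "submodule U (hecke N) V" and W: "submodule W (hecke N) V" and UW: "U \<subseteq> W"
begin

lemma module_quotient_restrict: "module_quotient (hecke N) (V\<lparr>carrier := W\<rparr>) U"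
  using left_module_restrict[OF left_module_act W]
    submodule_restrict[OF U W M.abelian_group_axioms UW]
  by (simp add: module_quotient_def module_quotient_axioms_def)

text \<open>A criterion for a factor in terms of congruences modulo \<open>U\<close> inside the big
  module, so that cosets need not be handled again. It serves both the flag and arbitrary
  series.\<close>

lemma factor_is_L:
  assumes u: "u \<in> W" "u \<notin> U" and span: "\<And>w. w \<in> W \<Longrightarrow> \<exists>c. w - scale c u \<in> U"
    and gens: "\<And>i. i \<in> {1..<N} \<Longrightarrow> op i u - (if i \<in> set_of_comp \<gamma> then 0 else u) \<in> U"
  shows "is_L N \<gamma> (quotient_module (V\<lparr>carrier := W\<rparr>) U)"
proof -
  let ?Q = "quotient_module (V\<lparr>carrier := W\<rparr>) U"
  interpret Q: module_quotient "hecke N" "V\<lparr>carrier := W\<rparr>" U by (rule module_quotient_restrict)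
  note coset = coset_eq_image[where U = U and W = W and S = S and act = act]
  have uS: "Poly_Mapping.keys u \<subseteq> S" using submoduleD(1)[OF W u(1)] .
  have scalar: "hecke_scalar N c \<odot>\<^bsub>?Q\<^esub> ((\<lambda>x. x + u) ` U) = (\<lambda>x. x + scale c u) ` U" for c
    using Q.smult_quotient[of "hecke_scalar N c" u] u hecke_scalar_closed act_scalar[OF uS]
    by (simp add: coset)
  have "w \<in> W \<Longrightarrow> \<exists>c. (\<lambda>x. x + w) ` U = (\<lambda>x. x + scale c u) ` U" for w
    using span coset_eq_iff[OF U] by blast
  moreover have "scale c u \<in> W" for c using submoduleD(4)[OF W u(1)] .
  ultimately have carrier: "carrier ?Q = {hecke_scalar N c \<odot>\<^bsub>?Q\<^esub> ((\<lambda>x. x + u) ` U) |c. True}"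
    unfolding Q.carrier_quotient coset scalar by auto
  have gen: "hecke_gen N i \<odot>\<^bsub>?Q\<^esub> ((\<lambda>x. x + u) ` U)
      = (if i \<in> set_of_comp \<gamma> then \<zero>\<^bsub>?Q\<^esub> else (\<lambda>x. x + u) ` U)" if i: "i \<in> {1..<N}" for i
  proof -
    have "hecke_gen N i \<odot>\<^bsub>?Q\<^esub> ((\<lambda>x. x + u) ` U) = (\<lambda>x. x + op i u) ` U"
      using Q.smult_quotient[of "hecke_gen N i" u] u hecke_gen_closed[OF i] act_gen[OF i uS]
      by (simp add: coset)
    also have "\<dots> = (\<lambda>x. x + (if i \<in> set_of_comp \<gamma> then 0 else u)) ` U"
      using gens[OF i] coset_eq_iff[OF U] by blast
    finally show ?thesis by (simp add: Q.zero_quotient coset)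
  qed
  have nz: "(\<lambda>x. x + u) ` U \<noteq> \<zero>\<^bsub>?Q\<^esub>"
    using coset_eq_iff[OF U, of u 0] u by (simp add: Q.zero_quotient coset)
  have "(\<lambda>x. x + u) ` U \<in> carrier ?Q" using u by (simp add: Q.carrier_quotient coset)
  then show ?thesis
    unfolding is_L_def
    by (intro conjI bexI[of _ "(\<lambda>x. x + u) ` U"] ballI Q.left_module_quotient nz carrier gen)
qed

text \<open>The part of the submodule correspondence that is used: the image of \<open>X\<close> in
  the quotient is a nonzero submodule, hence everything, and \<open>U \<subseteq> X\<close> lets
  this be pulled back to \<open>X = W\<close>.\<close>

lemma simple_factorD:
  assumes simple: "simple_module (hecke N) (quotient_module (V\<lparr>carrier := W\<rparr>) U)"
  shows "U \<noteq> W"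
    and "\<lbrakk>submodule X (hecke N) V; U \<subseteq> X; X \<subseteq> W; X \<noteq> U\<rbrakk> \<Longrightarrow> X = W"
proof -
  let ?Q = "quotient_module (V\<lparr>carrier := W\<rparr>) U"
  interpret Q: module_quotient "hecke N" "V\<lparr>carrier := W\<rparr>" U by (rule module_quotient_restrict)
  note coset = coset_eq_image[where U = U and W = W and S = S and act = act]
  have zero: "\<zero>\<^bsub>?Q\<^esub> = U" by (simp add: Q.zero_quotient coset)
  show "U \<noteq> W"
  proof
    assume "U = W"
    then have "(\<lambda>x. x + w) ` U = \<zero>\<^bsub>?Q\<^esub>" if "w \<in> W" for w
      using coset_eq_iff[OF U, of w 0] that zero by simp
    then have "carrier ?Q = (\<lambda>w. \<zero>\<^bsub>?Q\<^esub>) ` W"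
      unfolding Q.carrier_quotient by (simp add: coset cong: image_cong)
    also have "\<dots> = {\<zero>\<^bsub>?Q\<^esub>}" using submoduleD(2)[OF W] by (rule image_constant)
    finally have "carrier ?Q = {\<zero>\<^bsub>?Q\<^esub>}" .
    then show False using simple by (simp add: simple_module_def)
  qed
  show "X = W" if X: "submodule X (hecke N) V" "U \<subseteq> X" "X \<subseteq> W" "X \<noteq> U"
  proof -
    let ?X = "(\<lambda>x. (\<lambda>u. u + x) ` U) ` X"
    have "submodule ?X (hecke N) ?Q"
      using Q.submodule_quotient[OF submodule_restrict[OF X(1) W M.abelian_group_axioms X(3)]]
      by (simp add: coset)
    then have eq: "?X = carrier ?Q"
    proof (rule simple_module_submodule[OF simple])
      show "?X \<noteq> {\<zero>\<^bsub>?Q\<^esub>}"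
      proof
        assume *: "?X = {\<zero>\<^bsub>?Q\<^esub>}"
        have "x \<in> U" if "x \<in> X" for x
        proof -
          have "(\<lambda>u. u + x) ` U \<in> {\<zero>\<^bsub>?Q\<^esub>}" unfolding *[symmetric] using that by (rule imageI)
          then show ?thesis using coset_eq_iff[OF U, of x 0] zero by simp
        qed
        then show False using X by auto
      qed
    qed
    have "w \<in> X" if "w \<in> W" for w
    proof -
      have "(\<lambda>u. u + w) ` U \<in> ?X" using that by (simp add: eq Q.carrier_quotient coset)
      then obtain x where "x \<in> X" "w - x \<in> U" using coset_eq_iff[OF U] by blast
      then show ?thesis using submoduleD(3)[OF X(1), of "w - x" x] X(2) by auto
    qed
    then show ?thesis using X by auto
  qed
qed

end

end

section \<open>Counting the factors of a composition series\<close>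

text \<open>In the order of \<open>Ts\<close> all generators are simultaneously triangular, with
  diagonal entries 0 and 1; \<open>D\<close> records, for each basis vector, the generators whose
  diagonal entry is 0.\<close>

locale triangular_hecke_representation = hecke_representation op N S act
  for op :: "nat \<Rightarrow> ('b \<Rightarrow>\<^sub>0 complex) \<Rightarrow> ('b \<Rightarrow>\<^sub>0 complex)" and N S act +
  fixes Ts :: "'b list" and D :: "'b \<Rightarrow> nat set"
  assumes distinct: "distinct Ts" and set_Ts: "set Ts = S"
    and D_bounds: "T \<in> S \<Longrightarrow> D T \<subseteq> {1..<N}"
    and triangular: "\<lbrakk>i \<in> {1..<N}; j < length Ts\<rbrakk> \<Longrightarrow>
      Poly_Mapping.keys (op i (Poly_Mapping.single (Ts ! j) 1) -
        (if i \<in> D (Ts ! j) then 0 else Poly_Mapping.single (Ts ! j) 1)) \<subseteq> set (take j Ts)"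
begin

section \<open>The flag spanned by the initial segments of the basis\<close>

definition flag :: "nat \<Rightarrow> ('b \<Rightarrow>\<^sub>0 complex) set" where
  "flag j = {v. Poly_Mapping.keys v \<subseteq> set (take j Ts)}"

definition leader :: "nat \<Rightarrow> 'b \<Rightarrow>\<^sub>0 complex" where
  "leader j = Poly_Mapping.single (Ts ! j) 1"

lemma flag_zero_index: "flag 0 = {0}"
  by (auto simp: flag_def)

lemma flag_top: "flag (length Ts) = {v. Poly_Mapping.keys v \<subseteq> S}"
  by (simp add: flag_def set_Ts)

lemma flag_mono: "j \<le> k \<Longrightarrow> flag j \<subseteq> flag k"
  using set_take_subset_set_take[of j k Ts] by (auto simp: flag_def)

lemma zero_in_flag: "0 \<in> flag j"
  by (simp add: flag_def)

lemma flag_add: "u \<in> flag j \<Longrightarrow> v \<in> flag j \<Longrightarrow> u + v \<in> flag j"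
  using keys_add[of u v] by (auto simp: flag_def)

lemma flag_scale: "v \<in> flag j \<Longrightarrow> scale c v \<in> flag j"
  using keys_scale[of c v] by (auto simp: flag_def)

lemma flag_diff: "u \<in> flag j \<Longrightarrow> v \<in> flag j \<Longrightarrow> u - v \<in> flag j"
  using flag_add[of u j "scale (- 1) v"] flag_scale[of v j "- 1"] by (simp add: scale_minus_one)

lemma leader_in_flag: "j < length Ts \<Longrightarrow> leader j \<in> flag (Suc j)"
  by (simp add: flag_def leader_def take_Suc_conv_app_nth)

lemma leader_triangular:
  "i \<in> {1..<N} \<Longrightarrow> j < length Ts \<Longrightarrow>
    op i (leader j) - (if i \<in> D (Ts ! j) then 0 else leader j) \<in> flag j"
  using triangular[of i j] by (auto simp: flag_def leader_def split: if_splits)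

lemma flag_Suc_iff:
  assumes "j < length Ts"
  shows "v \<in> flag (Suc j) \<longleftrightarrow> v - scale (Poly_Mapping.lookup v (Ts ! j)) (leader j) \<in> flag j"
proof
  have "Ts ! j \<notin> set (take j Ts)"
    using distinct assms by (auto simp: in_set_conv_nth nth_eq_iff_index_eq)
  assume "v \<in> flag (Suc j)"
  then show "v - scale (Poly_Mapping.lookup v (Ts ! j)) (leader j) \<in> flag j"
    using assms
    by (auto simp: flag_def leader_def take_Suc_conv_app_nth in_keys_iff lookup_minus lookup_single
        when_def subset_iff split: if_splits)
next
  assume "v - scale (Poly_Mapping.lookup v (Ts ! j)) (leader j) \<in> flag j"
  then have "v - scale (Poly_Mapping.lookup v (Ts ! j)) (leader j) \<in> flag (Suc j)"
    using flag_mono[of j "Suc j"] by auto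
  then show "v \<in> flag (Suc j)"
    using flag_add[OF _ flag_scale[OF leader_in_flag[OF assms]]] by (metis diff_add_cancel)
qed

lemma lookup_flag:
  assumes "v \<in> flag j" "j < length Ts"
  shows "Poly_Mapping.lookup v (Ts ! j) = 0"
proof -
  have "Ts ! j \<notin> set (take j Ts)"
    using distinct assms by (auto simp: in_set_conv_nth nth_eq_iff_index_eq)
  then show ?thesis using assms by (auto simp: flag_def in_keys_iff)
qed

lemma op_flag:
  assumes i: "i \<in> {1..<N}"
  shows "v \<in> flag k \<Longrightarrow> k \<le> length Ts \<Longrightarrow> op i v \<in> flag k"
proof (induction k arbitrary: v)
  case 0
  then show ?case using op_scale[of i 0 0] by (simp add: flag_zero_index)
next
  case (Suc j)
  let ?w = "v - scale (Poly_Mapping.lookup v (Ts ! j)) (leader j)"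
  have w: "op i ?w \<in> flag (Suc j)"
    using Suc flag_Suc_iff[of j v] flag_mono[of j "Suc j"] by auto
  have "op i (leader j) - (if i \<in> D (Ts ! j) then 0 else leader j) \<in> flag (Suc j)"
    using leader_triangular[OF i, of j] Suc.prems flag_mono[of j "Suc j"] by auto
  then have "op i (leader j) \<in> flag (Suc j)"
    using flag_add[OF _ leader_in_flag[of j], of "op i (leader j) - leader j"] Suc.prems
    by (auto split: if_splits)
  then have "op i ?w + scale (Poly_Mapping.lookup v (Ts ! j)) (op i (leader j)) \<in> flag (Suc j)"
    using w by (intro flag_add flag_scale)
  then show ?case by (simp flip: op_scale op_add)
qed

text \<open>Triangularity passes from the basis vector to every \<open>v\<close> with that leading
  term: the rest of \<open>v\<close> lies in the stable subspace \<open>flag j\<close>, so the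
  generator acts on the whole factor as the scalar 0 or 1.\<close>

lemma op_triangular:
  assumes "v \<in> flag (Suc j)" and i: "i \<in> {1..<N}" and j: "j < length Ts"
  shows "op i v - (if i \<in> D (Ts ! j) then 0 else v) \<in> flag j"
proof -
  define c where "c = Poly_Mapping.lookup v (Ts ! j)"
  define w where "w = v - scale c (leader j)"
  have w: "w \<in> flag j" "op i w \<in> flag j"
    using assms flag_Suc_iff[OF j, of v] op_flag[OF i, of w j] by (auto simp: w_def c_def)
  have v: "v = w + scale c (leader j)" by (simp add: w_def)
  let ?\<epsilon> = "if i \<in> D (Ts ! j) then 0 else 1 :: complex"
  have "op i v - (if i \<in> D (Ts ! j) then 0 else v)
      = (op i w - scale ?\<epsilon> w)
        + scale c (op i (leader j) - (if i \<in> D (Ts ! j) then 0 else leader j))"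
    by (rule poly_mapping_eqI)
      (simp add: v op_add op_scale lookup_add lookup_minus algebra_simps)
  also have "\<dots> \<in> flag j"
    by (intro flag_add flag_diff flag_scale w leader_triangular i j)
  finally show ?thesis .
qed

lemma submodule_flag: "k \<le> length Ts \<Longrightarrow> submodule (flag k) (hecke N) V"
proof (rule submoduleI)
  show "Poly_Mapping.keys v \<subseteq> S" if "v \<in> flag k" for v
    using that set_take_subset[of k Ts] set_Ts by (auto simp: flag_def)
qed (auto simp: zero_in_flag flag_add flag_scale op_flag)

abbreviation descent_comp :: "nat \<Rightarrow> nat list" where
  "descent_comp j \<equiv> comp_of_set N (D (Ts ! j))"

lemma D_nth: "j < length Ts \<Longrightarrow> D (Ts ! j) \<subseteq> {1..<N}"
  using D_bounds set_Ts nth_mem by blast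

lemma flag_factor_is_L:
  assumes j: "j < length Ts"
  shows "is_L N (descent_comp j) (quotient_module (V\<lparr>carrier := flag (Suc j)\<rparr>) (flag j))"
proof (rule factor_is_L)
  show "leader j \<notin> flag j" using lookup_flag[of "leader j" j] j by (auto simp: leader_def)
  show "\<exists>c. w - scale c (leader j) \<in> flag j" if "w \<in> flag (Suc j)" for w
    using flag_Suc_iff[OF j] that by blast
  show "op i (leader j) - (if i \<in> set_of_comp (descent_comp j) then 0 else leader j) \<in> flag j"
    if "i \<in> {1..<N}" for i
    using leader_triangular[OF that j] set_of_comp_of_set[OF D_nth[OF j]] by simp
qed (use j in \<open>auto simp: submodule_flag leader_in_flag flag_mono\<close>)

lemma composition_series_flag:
  "composition_series (hecke N) V (map flag [0..<Suc (length Ts)])"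
  using is_L_simple[OF flag_factor_is_L]
  by (auto simp: composition_series_def chain_factor_def flag_zero_index flag_top hd_map last_map
      submodule_flag flag_mono nth_append simp del: upt_Suc)

section \<open>Comparison of an arbitrary composition series with the flag\<close>

context
  fixes Us
  assumes series: "composition_series (hecke N) V Us"
begin

text \<open>The step of \<open>Us\<close> at which the basis vector number \<open>j\<close> appears as a leading term.\<close>

definition jump :: "nat \<Rightarrow> nat \<Rightarrow> bool" where
  "jump i j \<longleftrightarrow> i + 1 < length Us \<and> j < length Ts \<and> Us ! (i + 1) \<inter> flag j \<subseteq> Us ! i \<and>
     \<not> Us ! (i + 1) \<inter> flag (Suc j) \<subseteq> Us ! i"

lemma series_submodule: "k < length Us \<Longrightarrow> submodule (Us ! k) (hecke N) V"
  using series by (simp add: composition_series_def)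

lemma series_step:
  assumes "i + 1 < length Us"
  shows "Us ! i \<subseteq> Us ! (i + 1)"
    and "simple_module (hecke N) (quotient_module (V\<lparr>carrier := Us ! (i + 1)\<rparr>) (Us ! i))"
  using series assms by (auto simp: composition_series_def chain_factor_def)

lemma series_mono: "i \<le> k \<Longrightarrow> k < length Us \<Longrightarrow> Us ! i \<subseteq> Us ! k"
proof (induction k rule: dec_induct)
  case (step k)
  then show ?case using series_step(1)[of k] by auto
qed simp

lemma series_ends: "Us \<noteq> []" "Us ! 0 = {0}" "Us ! (length Us - 1) = {v. Poly_Mapping.keys v \<subseteq> S}"
  using series by (auto simp: composition_series_def hd_conv_nth last_conv_nth)

text \<open>The new part of step \<open>i\<close> is invisible in \<open>flag 0\<close> and visible
  in the full flag, so there is a first index at which it appears.\<close>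

lemma jump_exists:
  assumes i: "i + 1 < length Us"
  shows "\<exists>j. jump i j"
proof -
  let ?P = "\<lambda>k. \<not> Us ! (i + 1) \<inter> flag k \<subseteq> Us ! i"
  note sub = series_submodule[OF i] series_submodule[of i]
  have "Us ! i \<noteq> Us ! (i + 1)"
    using simple_factorD(1)[OF sub(2) sub(1) series_step[OF i]] i by simp
  then have P: "?P (length Ts)"
    using series_step(1)[OF i] submoduleD(1)[OF sub(1)] by (fastforce simp: flag_top)
  have "\<not> ?P 0" using submoduleD(2)[OF sub(2)] i by (auto simp: flag_zero_index)
  then obtain j where "j < length Ts" "\<not> ?P j" "?P (Suc j)"
    using ex_least_nat_less[of ?P, OF P] by auto
  then show ?thesis using i by (auto simp: jump_def)
qed

text \<open>A vector \<open>u\<close> that is new at step \<open>i\<close> and has leading term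
  \<open>j\<close> generates the factor. Modulo \<open>Us ! i\<close> every generator multiplies it
  by 0 or 1, so its line is a submodule of the factor, and simplicity makes it the whole
  factor.\<close>

lemma jump_factor:
  assumes jump: "jump i j"
  obtains u where "u \<in> Us ! (i + 1)" "u \<in> flag (Suc j)" "u \<notin> Us ! i"
    and "\<And>w. w \<in> Us ! (i + 1) \<Longrightarrow> \<exists>c. w - scale c u \<in> Us ! i"
    and "is_L N (descent_comp j) (chain_factor V Us i)"
proof -
  obtain u where u: "u \<in> Us ! (i + 1)" "u \<in> flag (Suc j)" "u \<notin> Us ! i"
    using jump by (auto simp: jump_def)
  have i: "i + 1 < length Us" and j: "j < length Ts"
    and small: "Us ! (i + 1) \<inter> flag j \<subseteq> Us ! i"
    using jump by (auto simp: jump_def)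
  have sub: "submodule (Us ! (i + 1)) (hecke N) V" "submodule (Us ! i) (hecke N) V"
    using series_submodule i by auto
  note W = submoduleD[OF sub(1)] and U = submoduleD[OF sub(2)]
  \<comment> \<open>The error term lies in \<open>Us ! (i + 1)\<close> and, by triangularity, in
    \<open>flag j\<close>; by the choice of \<open>j\<close> this intersection is already contained
    in \<open>Us ! i\<close>.\<close>
  have gens: "op k u - (if k \<in> D (Ts ! j) then 0 else u) \<in> Us ! i" if k: "k \<in> {1..<N}" for k
  proof -
    have "op k u - (if k \<in> D (Ts ! j) then 0 else u) \<in> Us ! (i + 1)"
      using W(2,5) W(6)[OF k u(1)] u(1) by simp
    then show ?thesis using op_triangular[OF u(2) k j] small by blast
  qed
  define X where "X = {w + scale c u | w c. w \<in> Us ! i}"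
  have XI: "w + scale c u \<in> X" if "w \<in> Us ! i" for w c
    using that by (auto simp: X_def)
  have "submodule X (hecke N) V"
  proof (rule submoduleI)
    fix a v assume "v \<in> X"
    then obtain w c where v: "v = w + scale c u" "w \<in> Us ! i" by (auto simp: X_def)
    have "v \<in> Us ! (i + 1)" using v series_step(1)[OF i] W(3,4) u(1) by auto
    then show "Poly_Mapping.keys v \<subseteq> S" by (rule W(1))
    show "scale a v \<in> X" using XI[OF U(4)[OF v(2)], of a "a * c"] by (simp add: v scale_add_right)
    show "op k v \<in> X" if k: "k \<in> {1..<N}" for k
    proof -
      let ?\<epsilon> = "if k \<in> D (Ts ! j) then 0 else 1 :: complex"
      have "op k v = (op k w + scale c (op k u - (if k \<in> D (Ts ! j) then 0 else u)))
          + scale (c * ?\<epsilon>) u"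
        by (rule poly_mapping_eqI)
          (simp add: v op_add op_scale lookup_add lookup_minus algebra_simps)
      then show ?thesis using XI U(3)[OF U(6)[OF k v(2)] U(4)[OF gens[OF k]]] by metis
    qed
    fix v' assume "v' \<in> X"
    then obtain w' c' where v': "v' = w' + scale c' u" "w' \<in> Us ! i" by (auto simp: X_def)
    show "v + v' \<in> X"
      using XI[OF U(3)[OF v(2) v'(2)], of "c + c'"] by (simp add: v v' scale_add_left algebra_simps)
  next
    show "0 \<in> X" using XI[OF U(2), of 0] by simp
  qed
  moreover have "Us ! i \<subseteq> X" using XI[of _ 0] by auto
  moreover have "X \<subseteq> Us ! (i + 1)"
    using series_step(1)[OF i] W(3,4) u(1) by (auto simp: X_def)
  moreover have "X \<noteq> Us ! i" using XI[OF U(2), of 1] u(3) by auto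
  ultimately have X: "X = Us ! (i + 1)"
    using simple_factorD(2)[OF sub(2,1) series_step[OF i]] by blast
  have span: "\<exists>c. w - scale c u \<in> Us ! i" if w: "w \<in> Us ! (i + 1)" for w
  proof -
    obtain w' c where "w = w' + scale c u" "w' \<in> Us ! i"
      using w unfolding X[symmetric] by (auto simp: X_def)
    then show ?thesis by (intro exI[of _ c]) simp
  qed
  have "is_L N (descent_comp j) (chain_factor V Us i)"
    unfolding chain_factor_def
    by (rule factor_is_L[OF sub(2,1) series_step(1)[OF i] u(1,3) span])
      (use gens set_of_comp_of_set[OF D_nth[OF j]] in auto)
  then show ?thesis using that[OF u span] by blast
qed

lemma jump_unique_right:
  assumes "jump i j" "jump i k"
  shows "j = k"
proof -
  have "\<not> j < k" if "jump i j" "jump i k" for j k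
    using that flag_mono[of "Suc j" k] by (fastforce simp: jump_def)
  then show ?thesis using assms by (metis linorder_neqE_nat)
qed

text \<open>If \<open>j\<close> jumped at two steps, the earlier vector \<open>u\<close> would
  already lie in the lower module of the later step. Subtracting a multiple of it from
  \<open>u'\<close> cancels the leading term, so \<open>u'\<close> would not be new there.\<close>

lemma jump_unique_left:
  assumes "jump i j" "jump k j"
  shows "i = k"
proof -
  have "\<not> i < k" if jumps: "jump i j" "jump k j" for i k
  proof
    assume "i < k"
    have i: "i + 1 < length Us" "k + 1 < length Us" and j: "j < length Ts"
      using jumps by (auto simp: jump_def)
    have incl: "Us ! (i + 1) \<subseteq> Us ! k" using series_mono[of "i + 1" k] \<open>i < k\<close> i by simp
    note W = submoduleD[OF series_submodule[OF i(2)]]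
    note K = submoduleD[OF series_submodule[of k]]
    obtain u where u: "u \<in> Us ! (i + 1)" "u \<in> flag (Suc j)" "u \<notin> Us ! i"
      using jumps(1) by (auto simp: jump_def)
    obtain u' where u': "u' \<in> Us ! (k + 1)" "u' \<in> flag (Suc j)" "u' \<notin> Us ! k"
      using jumps(2) by (auto simp: jump_def)
    define a where "a = Poly_Mapping.lookup u (Ts ! j)"
    define b where "b = Poly_Mapping.lookup u' (Ts ! j)"
    have "a \<noteq> 0"
    proof
      assume "a = 0"
      then have "u \<in> flag j" using flag_Suc_iff[OF j, of u] u by (simp add: a_def)
      then show False using jumps(1) u by (auto simp: jump_def)
    qed
    \<comment> \<open>The factor \<open>b / a\<close> removes the coefficient at
      \<open>Ts ! j\<close>.\<close>
    let ?d = "u' - scale (b / a) u"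
    have "?d \<in> flag (Suc j)" using u u' by (intro flag_diff flag_scale)
    moreover have "Poly_Mapping.lookup ?d (Ts ! j) = 0"
      using \<open>a \<noteq> 0\<close> by (simp add: lookup_minus a_def b_def)
    ultimately have "?d \<in> flag j" using flag_Suc_iff[OF j, of ?d] by simp
    moreover have uk: "u \<in> Us ! k" using u incl by auto
    then have "?d \<in> Us ! (k + 1)"
      using W(4,5) u'(1) series_step(1)[OF i(2)] by blast
    ultimately have "?d \<in> Us ! k" using jumps(2) by (auto simp: jump_def)
    then have "?d + scale (b / a) u \<in> Us ! k"
      using K(3)[of ?d "scale (b / a) u"] K(4)[OF _ uk] i by auto
    then show False using u' by simp
  qed
  then show ?thesis using assms by (metis linorder_neqE_nat)
qed

text \<open>Let \<open>i\<close> be the step at which a vector \<open>u\<close> with leading term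
  \<open>j\<close> first occurs, and let \<open>k\<close> jump at \<open>i\<close>. Since
  \<open>u\<close> is new, \<open>k \<le> j\<close>. If \<open>k < j\<close>, then \<open>u\<close>
  is congruent modulo \<open>Us ! i\<close> to a multiple of a vector with lower leading term, and
  the difference is a vector of \<open>Us ! i\<close> that still has leading term
  \<open>j\<close>.\<close>

lemma jump_surj:
  assumes j: "j < length Ts"
  shows "\<exists>i. jump i j"
proof -
  define P where "P k \<longleftrightarrow> (\<exists>u\<in>Us ! k. u \<in> flag (Suc j) \<and> Poly_Mapping.lookup u (Ts ! j) \<noteq> 0)" for k
  have "leader j \<in> flag (length Ts)"
    using leader_in_flag[OF j] flag_mono[of "Suc j" "length Ts"] j by auto
  then have "P (length Us - 1)"
    unfolding P_def series_ends(3) flag_top using leader_in_flag[OF j]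
    by (intro bexI[of _ "leader j"]) (auto simp: leader_def)
  moreover have "\<not> P 0" by (simp add: P_def series_ends)
  ultimately obtain i where i: "i < length Us - 1" "\<not> P i" "P (Suc i)"
    using ex_least_nat_less[of P "length Us - 1"] by auto
  then obtain u where u: "u \<in> Us ! (i + 1)" "u \<in> flag (Suc j)" "Poly_Mapping.lookup u (Ts ! j) \<noteq> 0"
    by (auto simp: P_def)
  have "u \<notin> Us ! i" using i(2) u by (auto simp: P_def)
  obtain k where k: "jump i k" using jump_exists i(1) by fastforce
  then have kl: "k < length Ts" "i + 1 < length Us" by (auto simp: jump_def)
  have "\<not> j < k"
    using k u \<open>u \<notin> Us ! i\<close> flag_mono[of "Suc j" k] by (fastforce simp: jump_def)
  moreover have "\<not> k < j"
  proof
    assume "k < j"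
    obtain x c where x: "x \<in> flag (Suc k)" "u - scale c x \<in> Us ! i"
      using jump_factor[OF k] u(1) by metis
    have xj: "x \<in> flag j" using x \<open>k < j\<close> flag_mono[of "Suc k" j] by auto
    then have "u - scale c x \<in> flag (Suc j)"
      using u flag_mono[of j "Suc j"] by (intro flag_diff flag_scale) auto
    moreover have "Poly_Mapping.lookup (u - scale c x) (Ts ! j) \<noteq> 0"
      using lookup_flag[OF xj j] u by (simp add: lookup_minus)
    ultimately show False using i(2) x by (auto simp: P_def)
  qed
  ultimately show ?thesis using k by (metis linorder_neqE_nat)
qed

text \<open>\<open>jump\<close> matches the steps of the series one to one with the basis vectors,
  and a matched factor has the type of its descent composition. Restricting the matching to one
  \<gamma> compares the two counts.\<close>

lemma card_factors:
  assumes \<gamma>: "composition N \<gamma>"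
  shows "card {i. i + 1 < length Us \<and> is_L N \<gamma> (chain_factor V Us i)}
    = card {T \<in> S. comp_of_set N (D T) = \<gamma>}"
proof -
  have iff: "is_L N \<gamma> (chain_factor V Us i) \<longleftrightarrow> descent_comp j = \<gamma>" if "jump i j" for i j
  proof -
    have "j < length Ts" using that by (simp add: jump_def)
    moreover have "is_L N (descent_comp j) (chain_factor V Us i)"
      using jump_factor[OF that] by blast
    ultimately show ?thesis
      using is_L_unique[OF _ _ composition_comp_of_set \<gamma>] D_nth by blast
  qed
  define step where "step j = (THE i. jump i j)" for j
  have step: "jump (step j) j" if "j < length Ts" for j
    unfolding step_def using jump_surj[OF that] jump_unique_left theI' by metis
  have "bij_betw step {j. j < length Ts \<and> descent_comp j = \<gamma>}
      {i. i + 1 < length Us \<and> is_L N \<gamma> (chain_factor V Us i)}"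
  proof (rule bij_betw_imageI)
    show "inj_on step {j. j < length Ts \<and> descent_comp j = \<gamma>}"
      by (rule inj_onI) (metis (mono_tags, lifting) step jump_unique_right mem_Collect_eq)
    show "step ` {j. j < length Ts \<and> descent_comp j = \<gamma>}
        = {i. i + 1 < length Us \<and> is_L N \<gamma> (chain_factor V Us i)}"
    proof (intro equalityI subsetI)
      fix i assume "i \<in> step ` {j. j < length Ts \<and> descent_comp j = \<gamma>}"
      then obtain j where "j < length Ts" "descent_comp j = \<gamma>" "i = step j" by blast
      then show "i \<in> {i. i + 1 < length Us \<and> is_L N \<gamma> (chain_factor V Us i)}"
        using step[of j] iff[of i j] by (auto simp: jump_def)
    next
      fix i assume i: "i \<in> {i. i + 1 < length Us \<and> is_L N \<gamma> (chain_factor V Us i)}"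
      then obtain j where j: "jump i j" using jump_exists by blast
      then have "j < length Ts" by (simp add: jump_def)
      moreover from this have "i = step j" using step j jump_unique_left by blast
      ultimately show "i \<in> step ` {j. j < length Ts \<and> descent_comp j = \<gamma>}"
        using iff[OF j] i by blast
    qed
  qed
  moreover have "bij_betw ((!) Ts) {j. j < length Ts \<and> descent_comp j = \<gamma>}
      {T \<in> S. comp_of_set N (D T) = \<gamma>}"
  proof (rule bij_betw_imageI)
    show "inj_on ((!) Ts) {j. j < length Ts \<and> descent_comp j = \<gamma>}"
      using distinct by (auto simp: inj_on_def nth_eq_iff_index_eq)
    show "(!) Ts ` {j. j < length Ts \<and> descent_comp j = \<gamma>} = {T \<in> S. comp_of_set N (D T) = \<gamma>}"
      unfolding set_Ts[symmetric] set_conv_nth by auto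
  qed
  ultimately show ?thesis by (rule trans[OF sym[OF bij_betw_same_card] bij_betw_same_card])
qed

end

text \<open>The flag shows that some series exists; uniqueness of the count holds because
  \<open>card_factors\<close> applies to every series.\<close>

lemma multiplicity_L_eq:
  assumes "composition N \<gamma>"
  shows "multiplicity_L N V \<gamma> = card {T \<in> S. comp_of_set N (D T) = \<gamma>}"
  unfolding multiplicity_L_def
proof (rule the_equality)
  show "\<exists>Us. composition_series (hecke N) V Us \<and>
      card {T \<in> S. comp_of_set N (D T) = \<gamma>}
        = card {i. i + 1 < length Us \<and> is_L N \<gamma> (chain_factor V Us i)}"
    by (intro exI conjI)
      (rule composition_series_flag, rule card_factors[OF composition_series_flag assms, symmetric])
next
  fix k
  assume "\<exists>Us. composition_series (hecke N) V Us \<and>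
      k = card {i. i + 1 < length Us \<and> is_L N \<gamma> (chain_factor V Us i)}"
  then show "k = card {T \<in> S. comp_of_set N (D T) = \<gamma>}"
    by (elim exE conjE) (simp only: card_factors[OF _ assms])
qed

lemma qsym_characteristic_eq:
  "qsym_characteristic N V = (\<lambda>m. \<Sum>T\<in>S. fundamental_qsym (comp_of_set N (D T)) m)"
proof
  fix m
  have fin: "finite S" using set_Ts by auto
  have "(\<Sum>T\<in>S. fundamental_qsym (comp_of_set N (D T)) m)
      = (\<Sum>\<gamma> | composition N \<gamma>. \<Sum>T | T \<in> S \<and> comp_of_set N (D T) = \<gamma>.
          fundamental_qsym (comp_of_set N (D T)) m)"
  proof (rule sum.group[symmetric, OF fin finite_compositions])
    show "(\<lambda>T. comp_of_set N (D T)) ` S \<subseteq> {\<gamma>. composition N \<gamma>}"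
      using composition_comp_of_set[OF D_bounds] by blast
  qed
  also have "\<dots> = (\<Sum>\<gamma> | composition N \<gamma>. int (multiplicity_L N V \<gamma>) * fundamental_qsym \<gamma> m)"
    by (intro sum.cong refl) (simp add: multiplicity_L_eq)
  finally show "qsym_characteristic N V m = (\<Sum>T\<in>S. fundamental_qsym (comp_of_set N (D T)) m)"
    by (simp add: qsym_characteristic_def)
qed

end

section \<open>Sorting linear extensions of a labelled poset\<close>

definition sort_word :: "('c \<Rightarrow> int) \<Rightarrow> nat \<Rightarrow> (nat \<Rightarrow> 'c) \<Rightarrow> (nat \<Rightarrow> 'c)" where
  "sort_word \<kappa> i w = (if \<kappa> (w (i + 1)) < \<kappa> (w i) then w(i := w (i + 1), i + 1 := w i) else w)"

lemma sort_word_idem: "sort_word \<kappa> i (sort_word \<kappa> i w) = sort_word \<kappa> i w"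
  by (auto simp: sort_word_def)

text \<open>Both sides sort the entries at \<open>i\<close>, \<open>i + 1\<close>,
  \<open>i + 2\<close> by \<kappa> and keep the order of ties.\<close>

lemma sort_word_braid:
  "sort_word \<kappa> i (sort_word \<kappa> (i + 1) (sort_word \<kappa> i w))
    = sort_word \<kappa> (i + 1) (sort_word \<kappa> i (sort_word \<kappa> (i + 1) w))"
  by (auto simp: sort_word_def fun_eq_iff)

lemma sort_word_commute:
  "i + 2 \<le> j \<Longrightarrow> sort_word \<kappa> i (sort_word \<kappa> j w) = sort_word \<kappa> j (sort_word \<kappa> i w)"
  by (auto simp: sort_word_def fun_eq_iff)

text \<open>The inverse of a filling is meaningful on \<open>{1..N}\<close> only, so words are
  compared just there; for \<open>i < N\<close> the sorting step reads and writes within this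
  range.\<close>

lemma sort_word_cong:
  assumes "\<And>k. k \<in> {1..N} \<Longrightarrow> w k = w' k" "i \<in> {1..<N}" "k \<in> {1..N}"
  shows "sort_word \<kappa> i w k = sort_word \<kappa> i w' k"
  using assms(1)[of i] assms(1)[of "i + 1"] assms by (simp add: sort_word_def)

locale labelled_poset =
  fixes D :: "'c set" and N :: nat and lt :: "'c \<Rightarrow> 'c \<Rightarrow> bool" and \<kappa> :: "'c \<Rightarrow> int"
  assumes finite_D: "finite D" and inj_\<kappa>: "inj_on \<kappa> D"
begin

definition fillings :: "('c \<Rightarrow> nat) set" where
  "fillings = {T \<in> extensional D. bij_betw T D {1..N}}"

definition lin_exts :: "('c \<Rightarrow> nat) set" where
  "lin_exts = {T \<in> fillings. \<forall>x\<in>D. \<forall>y\<in>D. lt x y \<longrightarrow> T x < T y}"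

text \<open>Violating a relation that \<open>\<kappa>\<close> reverses cannot be repaired by sorting.\<close>

definition bad :: "('c \<Rightarrow> nat) set" where
  "bad = {T \<in> fillings. \<exists>x\<in>D. \<exists>y\<in>D. lt x y \<and> \<kappa> y < \<kappa> x \<and> T y < T x}"

definition pos :: "('c \<Rightarrow> nat) \<Rightarrow> nat \<Rightarrow> 'c" where
  "pos T i = inv_into D T i"

text \<open>The descent set of the word of labels
  \<open>\<kappa> (pos T 1), ..., \<kappa> (pos T N)\<close>, as in the theory of
  P-partitions.\<close>

definition descents :: "('c \<Rightarrow> nat) \<Rightarrow> nat set" where
  "descents T = {i \<in> {1..<N}. \<kappa> (pos T (i + 1)) < \<kappa> (pos T i)}"

definition swap :: "nat \<Rightarrow> ('c \<Rightarrow> nat) \<Rightarrow> ('c \<Rightarrow> nat)" where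
  "swap i T = restrict (transpose i (i + 1) \<circ> T) D"

definition sort_step :: "nat \<Rightarrow> ('c \<Rightarrow> nat) \<Rightarrow> ('c \<Rightarrow> nat)" where
  "sort_step i T = (if i \<in> descents T then swap i T else T)"

definition weight :: "('c \<Rightarrow> nat) \<Rightarrow> int" where
  "weight T = (\<Sum>x\<in>D. \<kappa> x * int (T x))"

lemma lin_exts_fillings: "T \<in> lin_exts \<Longrightarrow> T \<in> fillings"
  by (simp add: lin_exts_def)

lemma finite_lin_exts: "finite lin_exts"
proof (rule finite_subset)
  show "lin_exts \<subseteq> D \<rightarrow>\<^sub>E {1..N}"
    by (auto simp: lin_exts_def fillings_def PiE_def bij_betw_def)
qed (simp add: finite_PiE finite_D)

lemma
  assumes "T \<in> fillings" "i \<in> {1..N}"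
  shows pos_in: "pos T i \<in> D" and T_pos: "T (pos T i) = i"
  using assms unfolding fillings_def pos_def
  by (auto simp: bij_betw_def intro: inv_into_into f_inv_into_f)

lemma pos_T:
  assumes "T \<in> fillings" "x \<in> D"
  shows "pos T (T x) = x" "T x \<in> {1..N}"
  using assms unfolding fillings_def pos_def by (auto simp: bij_betw_def)

lemma pos_eqI:
  assumes "T \<in> fillings" "x \<in> D" "T x = i"
  shows "pos T i = x"
  using pos_T[OF assms(1,2)] assms(3) by simp

lemma filling_eqI:
  assumes "T \<in> fillings" "T' \<in> fillings" "\<And>k. k \<in> {1..N} \<Longrightarrow> pos T k = pos T' k"
  shows "T = T'"
proof (rule extensionalityI[of _ D])
  show "T x = T' x" if "x \<in> D" for x
    using assms pos_T[OF assms(1) that] T_pos[OF assms(2), of "T x"] by simp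
qed (use assms in \<open>auto simp: fillings_def\<close>)

lemma swap_filling:
  assumes "T \<in> fillings" "i \<in> {1..<N}"
  shows "swap i T \<in> fillings"
proof -
  have "bij_betw (transpose i (i + 1)) {1..N} {1..N}"
    by (rule bij_betw_byWitness[where f' = "transpose i (i + 1)"])
      (use assms(2) in \<open>auto simp: transpose_def\<close>)
  then have "bij_betw (transpose i (i + 1) \<circ> T) D {1..N}"
    using assms(1) by (intro bij_betw_trans) (auto simp: fillings_def)
  then show ?thesis
    by (simp add: fillings_def swap_def cong: bij_betw_cong)
qed

lemma sort_step_filling: "T \<in> fillings \<Longrightarrow> i \<in> {1..<N} \<Longrightarrow> sort_step i T \<in> fillings"
  by (simp add: sort_step_def swap_filling)

lemma pos_sort_step:
  assumes T: "T \<in> fillings" and i: "i \<in> {1..<N}" and k: "k \<in> {1..N}"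
  shows "pos (sort_step i T) k = sort_word \<kappa> i (pos T) k"
proof (cases "i \<in> descents T")
  case True
  have "pos (swap i T) k = pos T (transpose i (i + 1) k)"
  proof (rule pos_eqI[OF swap_filling[OF T i]])
    have *: "transpose i (i + 1) k \<in> {1..N}" using i k by (auto simp: transpose_def)
    show "pos T (transpose i (i + 1) k) \<in> D" using pos_in[OF T *] .
    then show "swap i T (pos T (transpose i (i + 1) k)) = k"
      using T_pos[OF T *] by (simp add: swap_def)
  qed
  then show ?thesis
    using True by (auto simp: sort_step_def sort_word_def descents_def transpose_def)
qed (use i in \<open>simp add: sort_step_def sort_word_def descents_def\<close>)

lemma foldr_sort_step:
  assumes "T \<in> fillings" "set ws \<subseteq> {1..<N}"
  shows "foldr sort_step ws T \<in> fillings
    \<and> (\<forall>k\<in>{1..N}. pos (foldr sort_step ws T) k = foldr (sort_word \<kappa>) ws (pos T) k)"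
  using assms(2)
proof (induction ws)
  case Nil
  then show ?case using assms by simp
next
  case (Cons i ws)
  then have IH: "foldr sort_step ws T \<in> fillings"
    "\<And>k. k \<in> {1..N} \<Longrightarrow> pos (foldr sort_step ws T) k = foldr (sort_word \<kappa>) ws (pos T) k"
    and i: "i \<in> {1..<N}" by auto
  show ?case
  proof (intro conjI ballI)
    show "foldr sort_step (i # ws) T \<in> fillings" using sort_step_filling[OF IH(1) i] by simp
    show "pos (foldr sort_step (i # ws) T) k = foldr (sort_word \<kappa>) (i # ws) (pos T) k"
      if k: "k \<in> {1..N}" for k
      using pos_sort_step[OF IH(1) i k] sort_word_cong[OF IH(2) i k] by simp
  qed
qed

text \<open>A filling is determined by its inverse on \<open>{1..N}\<close>, where sorting a filling
  becomes sorting a word; identities between sorting operators on words thus carry over to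
  fillings.\<close>

lemma foldr_sort_step_cong:
  assumes "T \<in> fillings" "set us \<subseteq> {1..<N}" "set ws \<subseteq> {1..<N}"
    and "\<And>w. foldr (sort_word \<kappa>) us w = foldr (sort_word \<kappa>) ws w"
  shows "foldr sort_step us T = foldr sort_step ws T"
  using foldr_sort_step[OF assms(1,2)] foldr_sort_step[OF assms(1,3)] assms(4)
  by (intro filling_eqI) auto

text \<open>Exchanging \<open>i\<close> and \<open>i + 1\<close> changes the relative order of no
  other pair of values. If \<open>T y = i\<close> and \<open>T x = i + 1\<close>, then
  \<open>\<kappa> y < \<kappa> x\<close> says that \<open>i\<close> is not a descent, and nothing is
  exchanged.\<close>

lemma sort_step_mono:
  assumes T: "T \<in> fillings" and xy: "x \<in> D" "y \<in> D" "\<kappa> y < \<kappa> x" "T y < T x"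
  shows "sort_step i T y < sort_step i T x"
proof (cases "i \<in> descents T")
  case True
  have "\<not> (T y = i \<and> T x = i + 1)"
    using True xy pos_eqI[OF T xy(1)] pos_eqI[OF T xy(2)] by (auto simp: descents_def)
  then show ?thesis using True xy by (auto simp: sort_step_def swap_def transpose_def)
qed (use xy in \<open>simp add: sort_step_def\<close>)

lemma sort_step_bad:
  assumes "T \<in> bad" "i \<in> {1..<N}"
  shows "sort_step i T \<in> bad"
proof -
  obtain x y where "x \<in> D" "y \<in> D" "lt x y" "\<kappa> y < \<kappa> x" "T y < T x" and T: "T \<in> fillings"
    using assms(1) by (auto simp: bad_def)
  then show ?thesis
    using sort_step_mono[OF T, of x y i] sort_step_filling[OF T assms(2)] by (auto simp: bad_def)
qed

lemma bad_not_lin_exts: "T \<in> bad \<Longrightarrow> T \<notin> lin_exts"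
  unfolding bad_def lin_exts_def by (auto dest: less_asym)

text \<open>Suppose that sorting breaks a relation \<open>lt x y\<close>. If
  \<open>\<kappa> x < \<kappa> y\<close>, the correct order of the pair would survive by
  \<open>sort_step_mono\<close>; so \<kappa> reverses the relation, and the result is in
  \<open>bad\<close>.\<close>

lemma sort_step_lin_exts:
  assumes T: "T \<in> lin_exts" and i: "i \<in> {1..<N}"
  shows "sort_step i T \<in> lin_exts \<union> bad"
proof (rule ccontr)
  assume not: "sort_step i T \<notin> lin_exts \<union> bad"
  have TF: "T \<in> fillings" using T by (rule lin_exts_fillings)
  note F = sort_step_filling[OF TF i]
  obtain x y where xy: "x \<in> D" "y \<in> D" "lt x y" "\<not> sort_step i T x < sort_step i T y"
    using not F by (auto simp: lin_exts_def)
  have lt: "T x < T y" using T xy by (auto simp: lin_exts_def)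
  then have "\<kappa> x \<noteq> \<kappa> y" using inj_onD[OF inj_\<kappa>] xy by auto
  moreover have "\<not> \<kappa> x < \<kappa> y" using sort_step_mono[OF TF xy(2,1) _ lt] xy by auto
  moreover have "sort_step i T x \<noteq> sort_step i T y"
    using pos_T(1)[OF F xy(1)] pos_T(1)[OF F xy(2)] lt by (metis less_irrefl)
  ultimately have "\<kappa> y < \<kappa> x" "sort_step i T y < sort_step i T x" using xy(4) by linarith+
  then have "sort_step i T \<in> bad" using F xy(1-3) unfolding bad_def by blast
  then show False using not by simp
qed

text \<open>On \<open>lin_exts \<union> bad\<close>, the only fillings that sorting reaches from a
  linear extension, this is the quotient map that kills \<open>bad\<close>.\<close>

definition proj :: "('c \<Rightarrow> nat) \<Rightarrow> ('c \<Rightarrow> nat) \<Rightarrow>\<^sub>0 complex" where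
  "proj T = (if T \<in> lin_exts then Poly_Mapping.single T 1 else 0)"

definition sort_op :: "nat \<Rightarrow> (('c \<Rightarrow> nat) \<Rightarrow>\<^sub>0 complex) \<Rightarrow> (('c \<Rightarrow> nat) \<Rightarrow>\<^sub>0 complex)" where
  "sort_op i = lin_extend (\<lambda>T. proj (sort_step i T))"

sublocale linear_operators sort_op
  by unfold_locales (simp_all add: sort_op_def lin_extend_add lin_extend_scale)

text \<open>Setting bad fillings to zero before or after a sorting step gives the same result,
  because sorting preserves \<open>bad\<close>.\<close>

lemma sort_op_proj:
  assumes "T \<in> lin_exts \<union> bad" "i \<in> {1..<N}"
  shows "sort_op i (proj T) = proj (sort_step i T)"
  using assms bad_not_lin_exts[of T] bad_not_lin_exts[of "sort_step i T"] sort_step_bad[of T i]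
  by (auto simp: sort_op_def proj_def)

lemma word_act_proj:
  assumes "T \<in> lin_exts \<union> bad" "set ws \<subseteq> {1..<N}"
  shows "word_act sort_op ws (proj T) = proj (foldr sort_step ws T) \<and>
    foldr sort_step ws T \<in> lin_exts \<union> bad"
  using assms(2)
proof (induction ws)
  case Nil
  then show ?case using assms by simp
next
  case (Cons i ws)
  then have IH: "word_act sort_op ws (proj T) = proj (foldr sort_step ws T)"
    "foldr sort_step ws T \<in> lin_exts \<union> bad" and i: "i \<in> {1..<N}" by auto
  show ?case
    using IH(1) sort_op_proj[OF IH(2) i] sort_step_lin_exts[OF _ i] sort_step_bad[OF _ i] IH(2)
    by auto
qed

text \<open>Reduces every relation between the operators to an identity of sorting operators on
  words. On a linear extension both sides are \<open>proj\<close> of one and the same filling, so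
  zeros on the two sides agree automatically.\<close>

lemma word_act_cong:
  assumes "set us \<subseteq> {1..<N}" "set ws \<subseteq> {1..<N}"
    and "\<And>w. foldr (sort_word \<kappa>) us w = foldr (sort_word \<kappa>) ws w"
    and v: "Poly_Mapping.keys v \<subseteq> lin_exts"
  shows "word_act sort_op us v = word_act sort_op ws v"
proof (induction v rule: poly_mapping_single_induct)
  case zero
  then show ?case by (metis free_act_scale_right word_act_scale scale_zero_left)
next
  case (single T)
  then have T: "T \<in> lin_exts" using v by auto
  have "Poly_Mapping.single T (Poly_Mapping.lookup v T) = scale (Poly_Mapping.lookup v T) (proj T)"
    using T by (simp add: proj_def)
  then show ?case
    using word_act_proj[of T us] word_act_proj[of T ws] T assms(1,2)
      foldr_sort_step_cong[OF lin_exts_fillings[OF T] assms(1-3)]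
    by (simp add: word_act_scale del: map_single)
next
  case (add u w)
  then show ?case by (simp add: word_act_add)
qed

lemma sort_op_closed:
  "Poly_Mapping.keys v \<subseteq> lin_exts \<Longrightarrow> Poly_Mapping.keys (sort_op i v) \<subseteq> lin_exts"
  unfolding sort_op_def by (rule keys_lin_extend) (auto simp: proj_def split: if_splits)

lemma hecke_representation_sort_op: "\<exists>act. hecke_representation sort_op N lin_exts act"
proof (rule hecke_representation_exists)
  fix i and v :: "('c \<Rightarrow> nat) \<Rightarrow>\<^sub>0 complex"
  assume "i \<in> {1..<N}" "Poly_Mapping.keys v \<subseteq> lin_exts"
  then show "sort_op i (sort_op i v) = sort_op i v"
    using word_act_cong[of "[i, i]" "[i]" v] by (simp add: sort_word_idem)
next
  fix i and v :: "('c \<Rightarrow> nat) \<Rightarrow>\<^sub>0 complex"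
  assume "i \<in> {1..<N}" "i + 1 \<in> {1..<N}" "Poly_Mapping.keys v \<subseteq> lin_exts"
  then show "sort_op i (sort_op (i + 1) (sort_op i v))
      = sort_op (i + 1) (sort_op i (sort_op (i + 1) v))"
    using word_act_cong[of "[i, i + 1, i]" "[i + 1, i, i + 1]" v] sort_word_braid[of \<kappa> i] by simp
next
  fix i j and v :: "('c \<Rightarrow> nat) \<Rightarrow>\<^sub>0 complex"
  assume "i \<in> {1..<N}" "j \<in> {1..<N}" "i + 2 \<le> j" "Poly_Mapping.keys v \<subseteq> lin_exts"
  then show "sort_op i (sort_op j v) = sort_op j (sort_op i v)"
    using word_act_cong[of "[i, j]" "[j, i]" v] sort_word_commute[of i j \<kappa>] by simp
qed (rule sort_op_closed)

lemma weight_swap: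
  assumes T: "T \<in> fillings" and i: "i \<in> descents T"
  shows "weight T < weight (swap i T)"
proof -
  let ?x = "pos T i" and ?y = "pos T (i + 1)"
  have iN: "i \<in> {1..N}" "i + 1 \<in> {1..N}" and \<kappa>: "\<kappa> ?y < \<kappa> ?x" using i by (auto simp: descents_def)
  have ne: "?x \<noteq> ?y" using \<kappa> by auto
  have "weight (swap i T) - weight T = (\<Sum>z\<in>D. \<kappa> z * (int (swap i T z) - int (T z)))"
    by (simp add: weight_def sum_subtractf algebra_simps)
  \<comment> \<open>Only two cells change: the entry of \<open>?x\<close> rises by one and that of
    \<open>?y\<close> falls by one.\<close>
  also have "\<dots> = (\<Sum>z\<in>D. (if z = ?x then \<kappa> z else 0) - (if z = ?y then \<kappa> z else 0))"
  proof (rule sum.cong[OF refl])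
    fix z assume z: "z \<in> D"
    have "T z = i \<longleftrightarrow> z = ?x" "T z = i + 1 \<longleftrightarrow> z = ?y"
      using pos_eqI[OF T z] T_pos[OF T] iN by auto
    then show "\<kappa> z * (int (swap i T z) - int (T z))
        = (if z = ?x then \<kappa> z else 0) - (if z = ?y then \<kappa> z else 0)"
      using z ne by (auto simp: swap_def transpose_def)
  qed
  also have "\<dots> = \<kappa> ?x - \<kappa> ?y"
    using pos_in[OF T] iN finite_D by (simp add: sum_subtractf)
  finally show ?thesis using \<kappa> by simp
qed

lemma qsym_characteristic_lin_exts:
  assumes "hecke_representation sort_op N lin_exts act"
  shows "qsym_characteristic N (span_module lin_exts act)
    = (\<lambda>m. \<Sum>T\<in>lin_exts. fundamental_qsym (comp_of_set N (descents T)) m)"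
proof -
  interpret hecke_representation sort_op N lin_exts act by fact
  obtain xs where xs: "set xs = lin_exts" "distinct xs"
    using finite_distinct_list[OF finite_lin_exts] by blast
  \<comment> \<open>Elements of equal weight may come in any order, since a swap at a descent
    strictly increases the weight.\<close>
  define Ts where "Ts = sort_key (\<lambda>T. - weight T) xs"
  have Ts: "set Ts = lin_exts" "distinct Ts" "sorted (map (\<lambda>T. - weight T) Ts)"
    using xs by (auto simp: Ts_def)
  interpret triangular_hecke_representation sort_op N lin_exts act Ts descents
  proof (unfold_locales)
    fix i j assume i: "i \<in> {1..<N}" and j: "j < length Ts"
    let ?T = "Ts ! j"
    have T: "?T \<in> lin_exts" using j Ts(1) nth_mem by blast
    have op: "sort_op i (Poly_Mapping.single ?T 1) = proj (sort_step i ?T)"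
      by (simp add: sort_op_def)
    show "Poly_Mapping.keys (sort_op i (Poly_Mapping.single ?T 1) -
        (if i \<in> descents ?T then 0 else Poly_Mapping.single ?T 1)) \<subseteq> set (take j Ts)"
    proof (cases "i \<in> descents ?T \<and> swap i ?T \<in> lin_exts")
      case True
      then obtain k where k: "k < length Ts" "Ts ! k = swap i ?T"
        using Ts(1) by (metis in_set_conv_nth)
      have "weight ?T < weight (Ts ! k)"
        using weight_swap[OF lin_exts_fillings[OF T]] True k by simp
      then have "k < j" using sorted_nth_mono[OF Ts(3), of j k] k j by (cases "j \<le> k") auto
      then have "swap i ?T \<in> set (take j Ts)"
        using k j by (auto simp: in_set_conv_nth intro!: exI[of _ k])
      then show ?thesis using True by (simp add: op sort_step_def proj_def)
    next
      \<comment> \<open>Either \<open>i\<close> is no descent and the basis vector is fixed, or the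
        swap leaves the linear extensions and the image is zero; the difference vanishes in both
        cases.\<close>
      case False
      then show ?thesis using T by (auto simp: op sort_step_def proj_def)
    qed
  qed (use Ts in \<open>auto simp: descents_def\<close>)
  show ?thesis by (rule qsym_characteristic_eq)
qed

end

section \<open>Skew standard immaculate tableaux\<close>

text \<open>Since columns lie in \<open>{0..<B}\<close>, the row acts as the leading digit in base
  \<open>B\<close>, and adding or subtracting the column decides ties.\<close>

lemma lexicographic_key_less_iff:
  fixes r r' c c' B :: int
  assumes "0 \<le> c" "c < B" "0 \<le> c'" "c' < B"
  shows "r * B + c < r' * B + c' \<longleftrightarrow> r < r' \<or> r = r' \<and> c < c'"
    and "r * B - c < r' * B - c' \<longleftrightarrow> r < r' \<or> r = r' \<and> c' < c"
proof -
  have step: "r * B + B \<le> r' * B" if "r < r'" for r r' :: int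
    using mult_right_mono[of "r + 1" r' B] that assms by (simp add: algebra_simps)
  show "r * B + c < r' * B + c' \<longleftrightarrow> r < r' \<or> r = r' \<and> c < c'"
    using step[of r r'] step[of r' r] assms by (cases r r' rule: linorder_cases) auto
  show "r * B - c < r' * B - c' \<longleftrightarrow> r < r' \<or> r = r' \<and> c' < c"
    using step[of r r'] step[of r' r] assms by (cases r r' rule: linorder_cases) auto
qed

text \<open>Encodes the order on cells for which \<open>i\<close> is a descent iff the cell of \<open>i + 1\<close> precedes
  the cell of \<open>i\<close>; \<open>B\<close> bounds the row lengths.\<close>

fun cell_key :: "action_kind \<Rightarrow> nat \<Rightarrow> cell \<Rightarrow> int" where
  "cell_key S_star B (r, c) = - (int r * int B - int c)"
| "cell_key RS_star B (r, c) = int r * int B - int c"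
| "cell_key A_star B (r, c) = int r * int B + int c"
| "cell_key Abar_star B (r, c) = - (int r * int B + int c)"

lemma cell_key_less_iff:
  assumes "c < B" "c' < B"
  shows "cell_key S_star B (r, c) < cell_key S_star B (r', c') \<longleftrightarrow> r' < r \<or> r = r' \<and> c < c'"
    and "cell_key RS_star B (r, c) < cell_key RS_star B (r', c') \<longleftrightarrow> r < r' \<or> r = r' \<and> c' < c"
    and "cell_key A_star B (r, c) < cell_key A_star B (r', c') \<longleftrightarrow> r < r' \<or> r = r' \<and> c < c'"
    and "cell_key Abar_star B (r, c) < cell_key Abar_star B (r', c') \<longleftrightarrow> r' < r \<or> r = r' \<and> c' < c"
proof -
  have B: "0 \<le> int c" "int c < int B" "0 \<le> int c'" "int c' < int B" using assms by auto
  note lex = lexicographic_key_less_iff[OF B] lexicographic_key_less_iff[OF B(3,4,1,2)]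
  show "cell_key S_star B (r, c) < cell_key S_star B (r', c') \<longleftrightarrow> r' < r \<or> r = r' \<and> c < c'"
    and "cell_key RS_star B (r, c) < cell_key RS_star B (r', c') \<longleftrightarrow> r < r' \<or> r = r' \<and> c' < c"
    and "cell_key A_star B (r, c) < cell_key A_star B (r', c') \<longleftrightarrow> r < r' \<or> r = r' \<and> c < c'"
    and "cell_key Abar_star B (r, c) < cell_key Abar_star B (r', c') \<longleftrightarrow> r' < r \<or> r = r' \<and> c' < c"
    unfolding cell_key.simps neg_less_iff_less lex by auto
qed

lemma cell_key_inj:
  assumes "c < B" "c' < B" "cell_key a B (r, c) = cell_key a B (r', c')"
  shows "(r, c) = (r', c')"
proof -
  have "\<not> cell_key a B (r, c) < cell_key a B (r', c')"
    "\<not> cell_key a B (r', c') < cell_key a B (r, c)"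
    using assms(3) by simp_all
  then have "r = r' \<and> c = c'"
    by (cases a; simp only: cell_key_less_iff[OF assms(1,2)] cell_key_less_iff[OF assms(2,1)];
        linarith)
  then show ?thesis by simp
qed

text \<open>The defining inequalities of a tableau, for the first column and for rows.
  \<open>cell_key\<close> reverses the row relations for \<open>RS_star\<close>, the column
  relations for \<open>S_star\<close>, both for \<open>Abar_star\<close> and none for
  \<open>A_star\<close>; a swap at a descent gives zero exactly when it violates a reversed
  relation.\<close>

definition cell_rel :: "cell \<Rightarrow> cell \<Rightarrow> bool" where
  "cell_rel x y \<longleftrightarrow> snd x = 0 \<and> snd y = 0 \<and> fst x < fst y \<or> fst x = fst y \<and> snd x < snd y"

context
  fixes \<alpha> \<beta> :: "nat list" and a :: action_kind
begin

abbreviation "width \<equiv> Suc (sum_list \<alpha>)"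

lemma skew_diagram_width: "(r, c) \<in> skew_diagram \<alpha> \<beta> \<Longrightarrow> c < width"
  using elem_le_sum_list[of r \<alpha>] by (auto simp: skew_diagram_def diagram_def)

lemma finite_skew_diagram: "finite (skew_diagram \<alpha> \<beta>)"
proof (rule finite_subset)
  show "skew_diagram \<alpha> \<beta> \<subseteq> {..<length \<alpha>} \<times> {..<width}"
    using skew_diagram_width by (auto simp: skew_diagram_def diagram_def)
qed simp

interpretation P: labelled_poset "skew_diagram \<alpha> \<beta>" "skew_size \<alpha> \<beta>" cell_rel "cell_key a width"
proof
  show "inj_on (cell_key a width) (skew_diagram \<alpha> \<beta>)"
  proof (rule inj_onI)
    fix x y assume "x \<in> skew_diagram \<alpha> \<beta>" "y \<in> skew_diagram \<alpha> \<beta>"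
      and "cell_key a width x = cell_key a width y"
    then show "x = y"
      by (cases x; cases y) (use cell_key_inj skew_diagram_width in blast)
  qed
qed (rule finite_skew_diagram)

lemma SIT_eq_lin_exts: "SIT \<alpha> \<beta> = P.lin_exts"
  unfolding SIT_def P.lin_exts_def P.fillings_def cell_rel_def by force

lemma SIT_row_less:
  "\<lbrakk>T \<in> SIT \<alpha> \<beta>; (r, c) \<in> skew_diagram \<alpha> \<beta>; (r, c') \<in> skew_diagram \<alpha> \<beta>; c < c'\<rbrakk>
    \<Longrightarrow> T (r, c) < T (r, c')"
  by (simp add: SIT_def)

lemma row_of_eq_pos:
  assumes T: "T \<in> SIT \<alpha> \<beta>" and i: "i \<in> {1..skew_size \<alpha> \<beta>}"
  shows "row_of \<alpha> \<beta> T i = fst (P.pos T i)"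
proof -
  have F: "T \<in> P.fillings" using T P.lin_exts_fillings SIT_eq_lin_exts by simp
  show ?thesis
    unfolding row_of_def
  proof (rule the_equality)
    show "\<exists>c. (fst (P.pos T i), c) \<in> skew_diagram \<alpha> \<beta> \<and> T (fst (P.pos T i), c) = i"
      using P.pos_in[OF F i] P.T_pos[OF F i] by (intro exI[of _ "snd (P.pos T i)"]) simp
  qed (use P.pos_eqI[OF F] in force)
qed

text \<open>For different rows both conditions compare rows. Within one row the cell of
  \<open>i\<close> is to the left of that of \<open>i + 1\<close>, so the column part of
  \<open>cell_key\<close> yields no descent in the strict cases and a descent in the weak
  ones.\<close>

lemma Des_eq_descents:
  assumes T: "T \<in> SIT \<alpha> \<beta>"
  shows "Des a \<alpha> \<beta> T = P.descents T"
proof -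
  have F: "T \<in> P.fillings" using T P.lin_exts_fillings SIT_eq_lin_exts by simp
  have "descent_rel a (row_of \<alpha> \<beta> T i) (row_of \<alpha> \<beta> T (i + 1))
      \<longleftrightarrow> cell_key a width (P.pos T (i + 1)) < cell_key a width (P.pos T i)"
    if i: "i \<in> {1..<skew_size \<alpha> \<beta>}" for i
  proof -
    have iN: "i \<in> {1..skew_size \<alpha> \<beta>}" "i + 1 \<in> {1..skew_size \<alpha> \<beta>}" using i by auto
    obtain r c where rc: "P.pos T i = (r, c)" by fastforce
    obtain r' c' where rc': "P.pos T (i + 1) = (r', c')" by fastforce
    have D: "(r, c) \<in> skew_diagram \<alpha> \<beta>" "T (r, c) = i"
      "(r', c') \<in> skew_diagram \<alpha> \<beta>" "T (r', c') = i + 1"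
      using P.pos_in[OF F] P.T_pos[OF F] iN rc rc' by metis+
    have "c < c'" if "r = r'"
      using SIT_row_less[OF T, of r c' c] D that by (cases c c' rule: linorder_cases) auto
    moreover have "row_of \<alpha> \<beta> T i = r" "row_of \<alpha> \<beta> T (i + 1) = r'"
      using row_of_eq_pos[OF T iN(1)] row_of_eq_pos[OF T iN(2)] rc rc' by simp_all
    moreover note less = cell_key_less_iff[OF skew_diagram_width[OF D(3)] skew_diagram_width[OF D(1)]]
    ultimately show ?thesis
      unfolding rc rc' by (cases a; simp only: descent_rel.simps less; linarith)
  qed
  then show ?thesis unfolding Des_def P.descents_def by blast
qed

lemma swap_entries_eq_swap: "swap_entries \<alpha> \<beta> i T = P.swap i T"
  by (simp add: swap_entries_def P.swap_def)

lemma pi_action_eq_sort: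
  assumes "T \<in> SIT \<alpha> \<beta>"
  shows "pi_action a \<alpha> \<beta> i T = P.proj (P.sort_step i T)"
  using assms Des_eq_descents[OF assms]
  by (simp add: pi_action_def P.proj_def P.sort_step_def basis_vector_def swap_entries_eq_swap
      SIT_eq_lin_exts)

lemma tableau_module_eq_span_module: "tableau_module \<alpha> \<beta> act = span_module P.lin_exts act"
  by (simp add: tableau_module_def span_module_def SIT_eq_lin_exts)

text \<open>Carries all admissible \<open>act\<close> at once into the abstract setting: their
  values on tableaux determine, by linearity, that generators act on the span as
  \<open>P.sort_op\<close>.\<close>

lemma extends_action_iff:
  "extends_action (skew_size \<alpha> \<beta>) a \<alpha> \<beta> act
    \<longleftrightarrow> hecke_representation P.sort_op (skew_size \<alpha> \<beta>) P.lin_exts act"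
proof
  assume ext: "extends_action (skew_size \<alpha> \<beta>) a \<alpha> \<beta> act"
  show "hecke_representation P.sort_op (skew_size \<alpha> \<beta>) P.lin_exts act"
  proof (intro hecke_representation.intro hecke_representation_axioms.intro P.linear_operators_axioms)
    fix i and v :: "tableau \<Rightarrow>\<^sub>0 complex"
    assume iv: "i \<in> {1..<skew_size \<alpha> \<beta>}" "Poly_Mapping.keys v \<subseteq> P.lin_exts"
    show "act (hecke_gen (skew_size \<alpha> \<beta>) i) v = P.sort_op i v"
      unfolding P.sort_op_def
      by (rule act_gen_lin_extend[OF _ _ _ iv])
        (use ext iv(1) in \<open>auto simp: extends_action_def tableau_module_eq_span_module
          SIT_eq_lin_exts pi_action_eq_sort basis_vector_def\<close>)
  qed (use ext in \<open>auto simp: extends_action_def tableau_module_eq_span_module P.sort_op_closed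
      intro: P.sort_op_closed[THEN subsetD]\<close>)
next
  assume "hecke_representation P.sort_op (skew_size \<alpha> \<beta>) P.lin_exts act"
  then interpret hecke_representation P.sort_op "skew_size \<alpha> \<beta>" P.lin_exts act .
  show "extends_action (skew_size \<alpha> \<beta>) a \<alpha> \<beta> act"
    unfolding extends_action_def tableau_module_eq_span_module
    using left_module_act act_scalar act_gen
    by (auto simp: SIT_eq_lin_exts pi_action_eq_sort basis_vector_def P.sort_op_def)
qed

lemma extends_action_exists: "\<exists>act. extends_action (skew_size \<alpha> \<beta>) a \<alpha> \<beta> act"
  using P.hecke_representation_sort_op by (simp add: extends_action_iff)

lemma qsym_characteristic_tableau_module:
  assumes "extends_action (skew_size \<alpha> \<beta>) a \<alpha> \<beta> act"
  shows "qsym_characteristic (skew_size \<alpha> \<beta>) (tableau_module \<alpha> \<beta> act) = skew_qsym a \<alpha> \<beta>"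
  using P.qsym_characteristic_lin_exts assms
  by (simp add: extends_action_iff tableau_module_eq_span_module skew_qsym_def Des_eq_descents
      flip: SIT_eq_lin_exts cong: sum.cong)

end

theorem theorem4p8:
  fixes \<alpha> \<beta> :: "nat list" and n m :: nat
  assumes "composition n \<alpha>" and "composition m \<beta>" and "comp_contained \<beta> \<alpha>"
  shows
    "((\<exists>act. extends_action (n - m) RS_star \<alpha> \<beta> act) \<and>
      (\<forall>act. extends_action (n - m) RS_star \<alpha> \<beta> act \<longrightarrow>
         qsym_characteristic (n - m) (tableau_module \<alpha> \<beta> act) = skew_qsym RS_star \<alpha> \<beta>)) \<and>
     ((\<exists>act. extends_action (n - m) S_star \<alpha> \<beta> act) \<and>
      (\<forall>act. extends_action (n - m) S_star \<alpha> \<beta> act \<longrightarrow>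
         qsym_characteristic (n - m) (tableau_module \<alpha> \<beta> act) = skew_qsym S_star \<alpha> \<beta>)) \<and>
     ((\<exists>act. extends_action (n - m) A_star \<alpha> \<beta> act) \<and>
      (\<forall>act. extends_action (n - m) A_star \<alpha> \<beta> act \<longrightarrow>
         qsym_characteristic (n - m) (tableau_module \<alpha> \<beta> act) = skew_qsym A_star \<alpha> \<beta>)) \<and>
     ((\<exists>act. extends_action (n - m) Abar_star \<alpha> \<beta> act) \<and>
      (\<forall>act. extends_action (n - m) Abar_star \<alpha> \<beta> act \<longrightarrow>
         qsym_characteristic (n - m) (tableau_module \<alpha> \<beta> act) = skew_qsym Abar_star \<alpha> \<beta>))"
proof -
  have "n - m = skew_size \<alpha> \<beta>"
    using assms(1,2) by (simp add: composition_def skew_size_def)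
  then show ?thesis
    using extends_action_exists qsym_characteristic_tableau_module by simp
qed

end
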